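(* Let $F$ be a field and let $n$ and $r$ be integers such that $1\leq r<2n$. For integers $k$ and $l$ such that $\max\{0,r-n\}\leq k\leq \min\{r,n\}$ and $\max\{0,r-n\}\leq l\leq \min\{k,r-k\}$ define $w_{k,l}\in GL_{2n}(F)$ by $$w_{k,l}=\begin{bmatrix} I_k & 0& 0& 0&0 &0 \\ 0&0 & 0& I_{n-k}&0 & 0\\ 0& I_l &0 &0 &0 &0 \\ 0&0 &0 &0 & I_{k-l}&0 \\ 0& 0& I_{r-(k+l)}&0 &0 &0 \\ 0& 0&0 &0 &0 & I_{n-r+l} \end{bmatrix}.$$ Then $w_{k,l}\in S_{2n}$ and $$\left\{w_{k,l}: \max\{0,r-n\}\leq k \leq \min\{n,r\},\ \max\{0,r-n\}\leq l \leq \min\{k,r-k\} \right\}$$ is a complete set of $(\Delta S_n, S_{r}\times S_{2n-r})$-double coset representatives in $S_{2n}$. In particular, there is a bijection $$S\backslash GL_{2n}(F) /P_{r,2n-r} \overset{1:1}{\longleftrightarrow}\Delta S_n\backslash S_{2n}/(S_r \times S_{2n-r}).$$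
   Context: $I_m$ is the identity matrix of order $m$ (blocks of size $0$ are omitted); $\mathcal{M}_{m,n}(F)$ is the space of $m\times n$ matrices over $F$ and $\mathcal{M}_n(F)=\mathcal{M}_{n,n}(F)$. $$P_{r,2n-r} = \left\{ \begin{pmatrix} g_1 & x\\ 0 & g_2 \end{pmatrix} : g_1 \in GL_r(F),\ g_2 \in GL_{2n-r}(F),\ x \in \mathcal{M}_{r,2n-r}(F) \right\},$$ and the Shalika subgroup of $GL_{2n}(F)$ is $$S = \left\{ \begin{pmatrix} g & x\\ 0 & g \end{pmatrix} : g \in GL_n(F),\ x \in \mathcal{M}_n(F)\right\}.$$ $S_m$ (with a subscript) denotes the permutation group of $\{1,\dots,m\}$. The group $S_{2n}$ is regarded as a subgroup of $GL_{2n}(F)$ via permutation matrices: $\sigma\in S_{2n}$ corresponds to the matrix sending the standard basis vector $e_j$ to $e_{\sigma(j)}$ for $1\le j\le 2n$. $\Delta S_n$ is the subgroup of $S_{2n}$ consisting of those $\sigma$ such that $1\leq \sigma(j)\leq n$ and $\sigma(n+j)=n+\sigma(j)$ for $1\leq j \leq n$. $S_r$ and $S_{2n-r}$ are regarded as the subgroups of $S_{2n}$ permuting $\{1,\dots,r\}$ and $\{r+1,\dots,2n\}$ respectively (each fixing the other set pointwise), so that $S_r\times S_{2n-r}$ is a subgroup of $S_{2n}$. For subgroups $H,K$ of a group $G$, a subset $C\subset G$ is a complete set of $(H,K)$-double coset representatives in $G$ if $G$ is the disjoint union of the double cosets $HgK$, $g\in C$. *)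

theory Defs
  imports
    "Jordan_Normal_Form.Matrix"
    "HOL-Algebra.Coset"
    "HOL-Combinatorics.Permutations"
    "HOL-Library.Disjoint_Sets"
begin

section \<open>Double cosets\<close>

definition double_coset :: "('a, 'b) monoid_scheme \<Rightarrow> 'a set \<Rightarrow> 'a \<Rightarrow> 'a set \<Rightarrow> 'a set" where
  "double_coset G H g K = (H #>\<^bsub>G\<^esub> g) <#>\<^bsub>G\<^esub> K"

definition double_cosets :: "('a, 'b) monoid_scheme \<Rightarrow> 'a set \<Rightarrow> 'a set \<Rightarrow> 'a set set" where
  "double_cosets G H K = {double_coset G H g K | g. g \<in> carrier G}"

definition complete_double_coset_reps ::
    "('a, 'b) monoid_scheme \<Rightarrow> 'a set \<Rightarrow> 'a set \<Rightarrow> 'a set \<Rightarrow> bool" where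
  "complete_double_coset_reps G H K C \<longleftrightarrow>
     C \<subseteq> carrier G \<and>
     carrier G = (\<Union>g\<in>C. double_coset G H g K) \<and>
     disjoint_family_on (\<lambda>g. double_coset G H g K) C"

section \<open>The general linear group and its subgroups\<close>

definition GL :: "'a::field itself \<Rightarrow> nat \<Rightarrow> 'a mat monoid" where
  "GL ty m = units_of (ring_mat ty m ())"

definition parabolic :: "'a::field itself \<Rightarrow> nat \<Rightarrow> nat \<Rightarrow> 'a mat set" where
  "parabolic ty p q =
     {four_block_mat g1 x (0\<^sub>m q p) g2 | g1 g2 x.
        g1 \<in> carrier (GL ty p) \<and> g2 \<in> carrier (GL ty q) \<and> x \<in> carrier_mat p q}"

definition shalika :: "'a::field itself \<Rightarrow> nat \<Rightarrow> 'a mat set" where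
  "shalika ty n =
     {four_block_mat g x (0\<^sub>m n n) g | g x. g \<in> carrier (GL ty n) \<and> x \<in> carrier_mat n n}"

section \<open>Permutation matrices\<close>

text \<open>
  Permutations act on \<open>{1..m}\<close>, whereas matrix indices start at \<open>0\<close>.
  The \<open>1\<close> in column \<open>j\<close> is in row \<open>\<sigma> j\<close>, so that \<open>e\<^sub>j\<close> is sent to the basis vector
  with index \<open>\<sigma> j\<close>.
\<close>

definition perm_mat :: "'a::field itself \<Rightarrow> nat \<Rightarrow> (nat \<Rightarrow> nat) \<Rightarrow> 'a mat" where
  "perm_mat ty m \<sigma> = mat m m (\<lambda>(i, j). if Suc i = \<sigma> (Suc j) then 1 else 0)"

definition Sym :: "'a::field itself \<Rightarrow> nat \<Rightarrow> 'a mat set" where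
  "Sym ty m = perm_mat ty m ` {\<sigma>. \<sigma> permutes {1..m}}"

text \<open>The permutation group of \<open>{1..m}\<close>, as a group of matrices.\<close>

definition Sym_group :: "'a::field itself \<Rightarrow> nat \<Rightarrow> 'a mat monoid" where
  "Sym_group ty m = (GL ty m)\<lparr>carrier := Sym ty m\<rparr>"

definition Delta_Sym :: "'a::field itself \<Rightarrow> nat \<Rightarrow> 'a mat set" where
  "Delta_Sym ty n = perm_mat ty (2 * n) `
     {\<sigma>. \<sigma> permutes {1..2 * n} \<and>
         (\<forall>j\<in>{1..n}. 1 \<le> \<sigma> j \<and> \<sigma> j \<le> n \<and> \<sigma> (n + j) = n + \<sigma> j)}"

definition Sym_prod :: "'a::field itself \<Rightarrow> nat \<Rightarrow> nat \<Rightarrow> 'a mat set" where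
  "Sym_prod ty p q = perm_mat ty (p + q) `
     {\<sigma> \<circ> \<tau> | \<sigma> \<tau>. \<sigma> permutes {1..p} \<and> \<tau> permutes {p + 1..p + q}}"

section \<open>Block matrices\<close>

definition beside :: "'a::zero mat \<Rightarrow> 'a mat \<Rightarrow> 'a mat" where
  "beside A B = four_block_mat A B (0\<^sub>m 0 (dim_col A)) (0\<^sub>m 0 (dim_col B))"

text \<open>
  The argument is the list of block rows. The empty matrix \<open>0\<^sub>m 0 0\<close> is a neutral
  right argument for both \<^const>\<open>beside\<close> and \<^const>\<open>append_rows\<close>.
\<close>

definition block_mat :: "'a::zero mat list list \<Rightarrow> 'a mat" where
  "block_mat Bss = foldr append_rows (map (\<lambda>Bs. foldr beside Bs (0\<^sub>m 0 0)) Bss) (0\<^sub>m 0 0)"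

text \<open>
  The subtractions below are on natural numbers; none of them truncates for the admissible
  \<open>k\<close> and \<open>l\<close>. The last block size \<open>n - r + l\<close> is written \<open>n + l - r\<close> for this reason.
\<close>

definition w_mat :: "'a::field itself \<Rightarrow> nat \<Rightarrow> nat \<Rightarrow> nat \<Rightarrow> nat \<Rightarrow> 'a mat" where
  "w_mat ty n r k l =
     (let c1 = k; c2 = l; c3 = r - (k + l); c4 = n - k; c5 = k - l; c6 = n + l - r in
      block_mat
       [[1\<^sub>m k,      0\<^sub>m c1 c2, 0\<^sub>m c1 c3,         0\<^sub>m c1 c4,   0\<^sub>m c1 c5,   0\<^sub>m c1 c6],
        [0\<^sub>m c4 c1, 0\<^sub>m c4 c2, 0\<^sub>m c4 c3,         1\<^sub>m (n - k), 0\<^sub>m c4 c5,   0\<^sub>m c4 c6],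
        [0\<^sub>m c2 c1, 1\<^sub>m l,      0\<^sub>m c2 c3,         0\<^sub>m c2 c4,   0\<^sub>m c2 c5,   0\<^sub>m c2 c6],
        [0\<^sub>m c5 c1, 0\<^sub>m c5 c2, 0\<^sub>m c5 c3,         0\<^sub>m c5 c4,   1\<^sub>m (k - l), 0\<^sub>m c5 c6],
        [0\<^sub>m c3 c1, 0\<^sub>m c3 c2, 1\<^sub>m (r - (k + l)), 0\<^sub>m c3 c4,   0\<^sub>m c3 c5,   0\<^sub>m c3 c6],
        [0\<^sub>m c6 c1, 0\<^sub>m c6 c2, 0\<^sub>m c6 c3,         0\<^sub>m c6 c4,   0\<^sub>m c6 c5,   1\<^sub>m (n + l - r)]])"

text \<open>
  Natural-number subtraction: \<open>r - n\<close> is \<open>max {0, r - n}\<close> in integer notation.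
\<close>

definition admissible :: "nat \<Rightarrow> nat \<Rightarrow> nat \<Rightarrow> nat \<Rightarrow> bool" where
  "admissible n r k l \<longleftrightarrow>
     r - n \<le> k \<and> k \<le> min r n \<and> r - n \<le> l \<and> l \<le> min k (r - k)"

end

theory Submission
  imports Defs "Jordan_Normal_Form.Determinant" "HOL-Library.Function_Algebras"
begin

text \<open>
  Cosets of the parabolic subgroup are \<open>r\<close>-dimensional subspaces \<open>U\<close> of \<open>F\<^sup>2\<^sup>n\<close>, and the Shalika
  subgroup is the centralizer of the nilpotent map \<open>N\<close> with \<open>N e\<^sub>n\<^sub>+\<^sub>j = e\<^sub>j\<close> and \<open>N e\<^sub>j = 0\<close>.
  Choose a basis \<open>b\<close> of \<open>ker N = F\<^sup>n\<close> adapted to both \<open>U \<inter> ker N\<close> and \<open>N U\<close>, and preimages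
  \<open>c\<^sub>j\<close> of \<open>b\<^sub>j\<close> under \<open>N\<close>, taken in \<open>U\<close> whenever \<open>b\<^sub>j \<in> N U\<close>. The matrix with columns
  \<open>b, c\<close> lies in the Shalika subgroup and carries a coordinate subspace to \<open>U\<close>, so every
  double coset contains a permutation matrix. On permutations, an orbit is determined by the
  sizes of the two halves of \<open>\<sigma> {1..r}\<close> and of their overlap, that is, by \<open>k\<close> and \<open>l\<close>; these
  are recovered from \<open>dim N U = r - k\<close> and \<open>dim (U + N U) = 2 r - k - l\<close>, which are invariants
  already for the double cosets in the general linear group. Hence the same matrices represent
  both families of double cosets.
\<close>

section \<open>Double coset representatives\<close>

lemma double_coset_iff:
  "x \<in> double_coset G H g K \<longleftrightarrow> (\<exists>h\<in>H. \<exists>k\<in>K. x = h \<otimes>\<^bsub>G\<^esub> g \<otimes>\<^bsub>G\<^esub> k)"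
  by (auto simp: double_coset_def r_coset_def set_mult_def)

text \<open>If \<open>x = h g k\<close>, then \<open>g\<close> is recovered from \<open>x\<close> by
  the inverses of \<open>h\<close> and \<open>k\<close>, so factors can be absorbed into
  \<open>H\<close> and \<open>K\<close> in both directions. Hence double cosets that meet
  coincide.\<close>

lemma (in group) double_coset_eq:
  assumes H: "subgroup H G" and K: "subgroup K G" and g: "g \<in> carrier G"
    and x: "x \<in> double_coset G H g K"
  shows "double_coset G H x K = double_coset G H g K"
proof -
  obtain h k where h: "h \<in> H" and k: "k \<in> K" and xe: "x = h \<otimes> g \<otimes> k"
    using x by (auto simp: double_coset_iff)
  have hc: "h \<in> carrier G" and kc: "k \<in> carrier G"
    using subgroup.mem_carrier[OF H h] subgroup.mem_carrier[OF K k] .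
  show ?thesis
  proof (intro equalityI subsetI)
    fix y assume "y \<in> double_coset G H x K"
    then obtain h' k' where h': "h' \<in> H" and k': "k' \<in> K" and y: "y = h' \<otimes> x \<otimes> k'"
      by (auto simp: double_coset_iff)
    have "h' \<in> carrier G" "k' \<in> carrier G"
      using subgroup.mem_carrier[OF H h'] subgroup.mem_carrier[OF K k'] .
    then have "y = (h' \<otimes> h) \<otimes> g \<otimes> (k \<otimes> k')"
      using hc kc g by (simp add: y xe m_assoc)
    then show "y \<in> double_coset G H g K"
      using subgroup.m_closed[OF H h' h] subgroup.m_closed[OF K k k']
      by (auto simp: double_coset_iff)
  next
    fix y assume "y \<in> double_coset G H g K"
    then obtain h' k' where h': "h' \<in> H" and k': "k' \<in> K" and y: "y = h' \<otimes> g \<otimes> k'"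
      by (auto simp: double_coset_iff)
    have h'c: "h' \<in> carrier G" and k'c: "k' \<in> carrier G"
      using subgroup.mem_carrier[OF H h'] subgroup.mem_carrier[OF K k'] .
    \<comment> \<open>Cancellation is stated for right-nested products, the normal form produced by
      \<open>m_assoc\<close>.\<close>
    have "inv h \<otimes> (h \<otimes> z) = z" "k \<otimes> (inv k \<otimes> z) = z" if "z \<in> carrier G" for z
      using hc kc that by (simp_all flip: m_assoc)
    then have "y = (h' \<otimes> inv h) \<otimes> x \<otimes> (inv k \<otimes> k')"
      using hc kc g h'c k'c by (simp add: y xe m_assoc)
    then show "y \<in> double_coset G H x K"
      using subgroup.m_closed[OF H h' subgroup.m_inv_closed[OF H h]]
        subgroup.m_closed[OF K subgroup.m_inv_closed[OF K k] k']
      by (auto simp: double_coset_iff)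
  qed
qed

lemma (in group) double_coset_self:
  assumes "subgroup H G" and "subgroup K G" and "g \<in> carrier G"
  shows "g \<in> double_coset G H g K"
  using assms subgroup.one_closed[of H G] subgroup.one_closed[of K G]
  unfolding double_coset_iff by (metis l_one r_one)

text \<open>This is applied to two groups with one and the same set \<open>C\<close>; composing one
  bijection with the inverse of the other then compares the two families of double cosets.\<close>

lemma (in group) bij_betw_double_cosets:
  assumes H: "subgroup H G" and K: "subgroup K G"
    and C: "complete_double_coset_reps G H K C"
  shows "bij_betw (\<lambda>g. double_coset G H g K) C (double_cosets G H K)"
proof -
  have CG: "C \<subseteq> carrier G" and cover: "carrier G = (\<Union>g\<in>C. double_coset G H g K)"
    and disj: "disjoint_family_on (\<lambda>g. double_coset G H g K) C"
    using C by (auto simp: complete_double_coset_reps_def)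
  show ?thesis
  proof (rule bij_betw_imageI)
    show "inj_on (\<lambda>g. double_coset G H g K) C"
    proof (rule inj_onI, rule ccontr)
      fix g g' assume g: "g \<in> C" "g' \<in> C" "double_coset G H g K = double_coset G H g' K" "g \<noteq> g'"
      then have "double_coset G H g K \<inter> double_coset G H g' K = {}"
        using disj by (auto simp: disjoint_family_on_def)
      then show False
        using double_coset_self[OF H K, of g] g CG by blast
    qed
    show "(\<lambda>g. double_coset G H g K) ` C = double_cosets G H K"
    proof (intro equalityI subsetI)
      fix D assume "D \<in> double_cosets G H K"
      then obtain x where x: "x \<in> carrier G" "D = double_coset G H x K"
        by (auto simp: double_cosets_def)
      then obtain g where g: "g \<in> C" "x \<in> double_coset G H g K"
        using cover by blast
      then show "D \<in> (\<lambda>g. double_coset G H g K) ` C"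
        using double_coset_eq[OF H K _ g(2)] CG x(2) by blast
    qed (use CG in \<open>auto simp: double_cosets_def\<close>)
  qed
qed

text \<open>Since meeting double cosets are equal, disjointness reduces to the question whether one
  representative lies in the double coset of another.\<close>

lemma (in group) complete_double_coset_repsI:
  assumes H: "subgroup H G" and K: "subgroup K G" and CG: "C \<subseteq> carrier G"
    and cover: "\<And>x. x \<in> carrier G \<Longrightarrow> \<exists>g\<in>C. x \<in> double_coset G H g K"
    and uniq: "\<And>g g'. g \<in> C \<Longrightarrow> g' \<in> C \<Longrightarrow> g' \<in> double_coset G H g K \<Longrightarrow> g = g'"
  shows "complete_double_coset_reps G H K C"
  unfolding complete_double_coset_reps_def
proof (intro conjI)
  show "C \<subseteq> carrier G" by fact
  show "carrier G = (\<Union>g\<in>C. double_coset G H g K)"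
  proof (intro equalityI subsetI)
    fix x assume "x \<in> (\<Union>g\<in>C. double_coset G H g K)"
    then obtain g h k where "g \<in> C" "h \<in> H" "k \<in> K" "x = h \<otimes> g \<otimes> k"
      by (auto simp: double_coset_iff)
    moreover from this have "g \<in> carrier G" "h \<in> carrier G" "k \<in> carrier G"
      using CG subgroup.mem_carrier[OF H] subgroup.mem_carrier[OF K] by auto
    ultimately show "x \<in> carrier G"
      by simp
  qed (use cover in blast)
  show "disjoint_family_on (\<lambda>g. double_coset G H g K) C"
    unfolding disjoint_family_on_def
  proof (intro ballI impI, rule ccontr)
    fix g g' assume g: "g \<in> C" "g' \<in> C" "g \<noteq> g'"
      and "double_coset G H g K \<inter> double_coset G H g' K \<noteq> {}"
    then obtain x where "x \<in> double_coset G H g K" "x \<in> double_coset G H g' K"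
      by blast
    then have "double_coset G H g K = double_coset G H g' K"
      using double_coset_eq[OF H K] g CG by (metis subsetD)
    then have "g' \<in> double_coset G H g K"
      using double_coset_self[OF H K, of g'] g CG by blast
    then show False using uniq g by blast
  qed
qed

section \<open>Subgroups of permutation matrices\<close>

lemma GL_mult [simp]: "M \<otimes>\<^bsub>GL ty m\<^esub> N = M * N"
  by (simp add: GL_def units_of_mult ring_mat_simps)

lemma GL_one [simp]: "\<one>\<^bsub>GL ty m\<^esub> = 1\<^sub>m m"
  by (simp add: GL_def units_of_one ring_mat_simps)

text \<open>For square matrices over a field a right inverse is also a left inverse, so one equation
  certifies a unit.\<close>

lemma GL_carrier_iff:
  "M \<in> carrier (GL TYPE('a::field) m) \<longleftrightarrow>
     M \<in> carrier_mat m m \<and> (\<exists>M'\<in>carrier_mat m m. M * M' = 1\<^sub>m m)"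
  unfolding GL_def units_of_carrier Units_def ring_mat_simps
  by (auto dest: mat_mult_left_right_inverse)

lemma GL_iff_det:
  "M \<in> carrier (GL TYPE('a::field) m) \<longleftrightarrow> M \<in> carrier_mat m m \<and> det M \<noteq> 0"
proof
  assume "M \<in> carrier (GL TYPE('a) m)"
  then obtain M' where "M \<in> carrier_mat m m" "M' \<in> carrier_mat m m" "M * M' = 1\<^sub>m m"
    by (auto simp: GL_carrier_iff)
  then show "M \<in> carrier_mat m m \<and> det M \<noteq> 0"
    using det_mult[of M m M'] by auto
next
  assume "M \<in> carrier_mat m m \<and> det M \<noteq> 0"
  then show "M \<in> carrier (GL TYPE('a) m)"
    using det_non_zero_imp_unit[of M m "()"]
    by (auto simp: GL_def units_of_carrier ring_mat_def)
qed

lemma group_GL: "group (GL TYPE('a::field) m)"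
  unfolding GL_def by (intro monoid.units_group ring.is_monoid ring_mat)

lemma GL_carrierD: "M \<in> carrier (GL TYPE('a::field) m) \<Longrightarrow> M \<in> carrier_mat m m"
  by (simp add: GL_carrier_iff)

lemma GL_inv:
  assumes "M \<in> carrier (GL TYPE('a::field) m)"
  obtains M' where "M' \<in> carrier (GL TYPE('a) m)" "M * M' = 1\<^sub>m m" "M' * M = 1\<^sub>m m"
    "inv\<^bsub>GL TYPE('a) m\<^esub> M = M'"
proof -
  interpret group "GL TYPE('a) m" by (rule group_GL)
  show thesis
    using that[of "inv\<^bsub>GL TYPE('a) m\<^esub> M"] assms r_inv[OF assms] l_inv[OF assms] by simp
qed

section \<open>Permutation matrices\<close>

lemma perm_mat_carrier [simp]: "perm_mat ty m \<sigma> \<in> carrier_mat m m"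
  by (simp add: perm_mat_def)

lemma perm_mat_dim [simp]: "dim_row (perm_mat ty m \<sigma>) = m" "dim_col (perm_mat ty m \<sigma>) = m"
  by (simp_all add: perm_mat_def)

lemma perm_mat_index [simp]:
  "i < m \<Longrightarrow> j < m \<Longrightarrow> perm_mat ty m \<sigma> $$ (i, j) = (if Suc i = \<sigma> (Suc j) then 1 else 0)"
  by (simp add: perm_mat_def)

lemma permutes_atLeastAtMost_pred:
  assumes "\<sigma> permutes {1..m}" and "j < m"
  obtains i where "i < m" "\<sigma> (Suc j) = Suc i"
proof -
  have "\<sigma> (Suc j) \<in> {1..m}"
    using assms permutes_in_image[of \<sigma> "{1..m}" "Suc j"] by auto
  then show thesis
    using that[of "\<sigma> (Suc j) - 1"] by auto
qed

text \<open>Placing the one of column \<open>j\<close> in row \<open>\<sigma> j\<close> makes the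
  passage to matrices a homomorphism rather than an antihomomorphism.\<close>

lemma perm_mat_comp:
  assumes s: "\<sigma> permutes {1..m}" and t: "\<tau> permutes {1..m}"
  shows "perm_mat TYPE('a::field) m (\<sigma> \<circ> \<tau>) = perm_mat TYPE('a) m \<sigma> * perm_mat TYPE('a) m \<tau>"
proof (rule eq_matI)
  fix i j assume "i < dim_row (perm_mat TYPE('a) m \<sigma> * perm_mat TYPE('a) m \<tau>)"
    "j < dim_col (perm_mat TYPE('a) m \<sigma> * perm_mat TYPE('a) m \<tau>)"
  then have i: "i < m" and j: "j < m" by auto
  obtain k where k: "k < m" "\<tau> (Suc j) = Suc k"
    using permutes_atLeastAtMost_pred[OF t j] .
  have "(perm_mat TYPE('a) m \<sigma> * perm_mat TYPE('a) m \<tau>) $$ (i, j)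
      = (\<Sum>q\<in>{0..<m}. (if Suc i = \<sigma> (Suc q) then 1 else 0) * (if Suc q = \<tau> (Suc j) then 1 else 0))"
    using i j by (simp add: scalar_prod_def)
  \<comment> \<open>Column \<open>j\<close> of the right factor has its only nonzero entry in row
    \<open>k\<close>, so a single summand survives.\<close>
  also have "\<dots> = (\<Sum>q\<in>{0..<m}. if q = k then (if Suc i = \<sigma> (Suc k) then 1 else 0) else 0)"
    by (intro sum.cong) (auto simp: k)
  also have "\<dots> = perm_mat TYPE('a) m (\<sigma> \<circ> \<tau>) $$ (i, j)"
    using i j k by simp
  finally show "perm_mat TYPE('a) m (\<sigma> \<circ> \<tau>) $$ (i, j)
      = (perm_mat TYPE('a) m \<sigma> * perm_mat TYPE('a) m \<tau>) $$ (i, j)" by simp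
qed auto

lemma perm_mat_id: "perm_mat TYPE('a::field) m id = 1\<^sub>m m"
  by (rule eq_matI) auto

text \<open>Common source of the subgroup property of \<open>Sym\<close>, \<open>Delta_Sym\<close>
  and \<open>Sym_prod\<close>: closure is checked on permutations and transported to
  matrices.\<close>

lemma subgroup_perm_mat_image:
  assumes perm: "\<And>\<sigma>. \<sigma> \<in> \<Sigma> \<Longrightarrow> \<sigma> permutes {1..m}" and "id \<in> \<Sigma>"
    and "\<And>\<sigma> \<tau>. \<sigma> \<in> \<Sigma> \<Longrightarrow> \<tau> \<in> \<Sigma> \<Longrightarrow> \<sigma> \<circ> \<tau> \<in> \<Sigma>"
    and "\<And>\<sigma>. \<sigma> \<in> \<Sigma> \<Longrightarrow> Hilbert_Choice.inv \<sigma> \<in> \<Sigma>"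
  shows "subgroup (perm_mat TYPE('a::field) m ` \<Sigma>) (GL TYPE('a) m)"
proof -
  interpret group "GL TYPE('a) m" by (rule group_GL)
  have invs: "perm_mat TYPE('a) m \<sigma> * perm_mat TYPE('a) m (Hilbert_Choice.inv \<sigma>) = 1\<^sub>m m" if "\<sigma> \<in> \<Sigma>" for \<sigma>
    using that perm[OF that] perm_mat_comp[of \<sigma> m "Hilbert_Choice.inv \<sigma>", where ?'a = 'a]
    by (simp add: perm_mat_id permutes_inv permutes_inv_o)
  have car: "perm_mat TYPE('a) m \<sigma> \<in> carrier (GL TYPE('a) m)" if "\<sigma> \<in> \<Sigma>" for \<sigma>
    unfolding GL_carrier_iff using invs[OF that] perm_mat_carrier by blast
  show ?thesis
  proof (rule subgroupI)
    show "perm_mat TYPE('a) m ` \<Sigma> \<subseteq> carrier (GL TYPE('a) m)" using car by blast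
    show "perm_mat TYPE('a) m ` \<Sigma> \<noteq> {}" using assms(2) by blast
  next
    fix a assume "a \<in> perm_mat TYPE('a) m ` \<Sigma>"
    then obtain \<sigma> where s: "\<sigma> \<in> \<Sigma>" "a = perm_mat TYPE('a) m \<sigma>" by blast
    have "inv\<^bsub>GL TYPE('a) m\<^esub> a = perm_mat TYPE('a) m (Hilbert_Choice.inv \<sigma>)"
      using s invs[OF s(1)] car assms(4) by (intro inv_equality) (auto dest: mat_mult_left_right_inverse[rotated 2])
    then show "inv\<^bsub>GL TYPE('a) m\<^esub> a \<in> perm_mat TYPE('a) m ` \<Sigma>" using s assms(4) by blast
  next
    fix a b assume "a \<in> perm_mat TYPE('a) m ` \<Sigma>" "b \<in> perm_mat TYPE('a) m ` \<Sigma>"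
    then obtain \<sigma> \<tau> where s: "\<sigma> \<in> \<Sigma>" "a = perm_mat TYPE('a) m \<sigma>"
      and t: "\<tau> \<in> \<Sigma>" "b = perm_mat TYPE('a) m \<tau>" by blast
    then have "a * b = perm_mat TYPE('a) m (\<sigma> \<circ> \<tau>)"
      using perm_mat_comp perm by metis
    then show "a \<otimes>\<^bsub>GL TYPE('a) m\<^esub> b \<in> perm_mat TYPE('a) m ` \<Sigma>"
      using s t assms(3) by simp
  qed
qed

lemma subgroup_Sym: "subgroup (Sym TYPE('a::field) m) (GL TYPE('a) m)"
  unfolding Sym_def
  by (rule subgroup_perm_mat_image) (auto intro: permutes_id permutes_compose permutes_inv)

lemma group_Sym_group: "group (Sym_group TYPE('a::field) m)"
  unfolding Sym_group_def by (rule subgroup.subgroup_is_group[OF subgroup_Sym group_GL])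

lemma Sym_group_mult [simp]: "M \<otimes>\<^bsub>Sym_group ty m\<^esub> N = M * N"
  by (simp add: Sym_group_def)

lemma Sym_group_carrier [simp]: "carrier (Sym_group ty m) = Sym ty m"
  by (simp add: Sym_group_def)

section \<open>Diagonal permutations\<close>

definition diagonal_perms :: "nat \<Rightarrow> (nat \<Rightarrow> nat) set" where
  "diagonal_perms n = {\<sigma>. \<sigma> permutes {1..2 * n} \<and>
     (\<forall>j\<in>{1..n}. 1 \<le> \<sigma> j \<and> \<sigma> j \<le> n \<and> \<sigma> (n + j) = n + \<sigma> j)}"

lemma diagonal_perms_permutes: "\<sigma> \<in> diagonal_perms n \<Longrightarrow> \<sigma> permutes {1..2 * n}"
  by (simp add: diagonal_perms_def)

lemma diagonal_perms_id: "id \<in> diagonal_perms n"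
  by (simp add: diagonal_perms_def permutes_id)

lemma permutes_image_eq_iff:
  assumes "finite A" and "\<sigma> permutes S"
  shows "\<sigma> ` A = A \<longleftrightarrow> (\<forall>j\<in>A. \<sigma> j \<in> A)"
  using assms endo_inj_surj[of A \<sigma>] permutes_inj[of \<sigma> S]
  by (auto simp: inj_on_def inj_def)

lemma diagonal_perms_inv:
  assumes s: "\<sigma> \<in> diagonal_perms n"
  shows "Hilbert_Choice.inv \<sigma> \<in> diagonal_perms n"
proof -
  have p: "\<sigma> permutes {1..2 * n}" using s by (simp add: diagonal_perms_def)
  \<comment> \<open>The definition only gives an inclusion. Injectivity on a finite set upgrades it
    to equality, so every \<open>j\<close> in \<open>{1..n}\<close> has a preimage there.\<close>
  have im: "\<sigma> ` {1..n} = {1..n}"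
    using s permutes_image_eq_iff[OF _ p, of "{1..n}"] by (auto simp: diagonal_perms_def)
  have "1 \<le> Hilbert_Choice.inv \<sigma> j \<and> Hilbert_Choice.inv \<sigma> j \<le> n \<and> Hilbert_Choice.inv \<sigma> (n + j) = n + Hilbert_Choice.inv \<sigma> j" if "j \<in> {1..n}" for j
  proof -
    obtain i where i: "i \<in> {1..n}" "j = \<sigma> i" using im \<open>j \<in> {1..n}\<close> by blast
    then have "n + j = \<sigma> (n + i)" using s by (auto simp: diagonal_perms_def)
    then show ?thesis using i permutes_inverses(2)[OF p] by auto
  qed
  then show ?thesis using permutes_inv[OF p] by (auto simp: diagonal_perms_def)
qed

lemma diagonal_perms_comp:
  assumes "\<sigma> \<in> diagonal_perms n" and "\<tau> \<in> diagonal_perms n"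
  shows "\<sigma> \<circ> \<tau> \<in> diagonal_perms n"
  using assms by (auto simp: diagonal_perms_def intro: permutes_compose)

lemma Delta_Sym_eq: "Delta_Sym ty n = perm_mat ty (2 * n) ` diagonal_perms n"
  by (simp add: Delta_Sym_def diagonal_perms_def)

lemma subgroup_Delta_Sym_GL:
  "subgroup (Delta_Sym TYPE('a::field) n) (GL TYPE('a) (2 * n))"
  unfolding Delta_Sym_eq
  by (intro subgroup_perm_mat_image diagonal_perms_inv diagonal_perms_comp
      diagonal_perms_permutes diagonal_perms_id)

section \<open>The product of two symmetric groups as a stabilizer\<close>

lemma permutes_if:
  assumes "bij_betw f A A"
  shows "(\<lambda>j. if j \<in> A then f j else j) permutes A"
  using permutes_restrict_id[OF assms] by (simp add: restrict_id_def)

text \<open>The setwise stabilizer of \<open>{1..p}\<close>. In this form, membership of a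
  permutation is read off from one image, which is what the comparison of double cosets
  provides.\<close>

definition block_perms :: "nat \<Rightarrow> nat \<Rightarrow> (nat \<Rightarrow> nat) set" where
  "block_perms p m = {\<sigma>. \<sigma> permutes {1..m} \<and> \<sigma> ` {1..p} = {1..p}}"

text \<open>A permutation preserving \<open>{1..p}\<close> also preserves the complement in
  \<open>{1..p + q}\<close>, so it is the product of its two restrictions, each extended by the
  identity.\<close>

lemma block_perms_eq:
  "block_perms p (p + q) = {\<sigma> \<circ> \<tau> | \<sigma> \<tau>. \<sigma> permutes {1..p} \<and> \<tau> permutes {p + 1..p + q}}"
proof (intro equalityI subsetI)
  fix \<rho> assume "\<rho> \<in> block_perms p (p + q)"
  then have p: "\<rho> permutes {1..p + q}" and im: "\<rho> ` {1..p} = {1..p}"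
    by (auto simp: block_perms_def)
  define \<sigma> where "\<sigma> = (\<lambda>j. if j \<in> {1..p} then \<rho> j else j)"
  define \<tau> where "\<tau> = (\<lambda>j. if j \<in> {1..p} then j else \<rho> j)"
  have inj: "\<rho> i = \<rho> j \<longleftrightarrow> i = j" for i j using permutes_inj[OF p] by (auto simp: inj_def)
  have s: "\<sigma> permutes {1..p}"
    unfolding \<sigma>_def
    by (rule permutes_if) (use im permutes_inj_on[OF p] in \<open>simp add: bij_betw_def\<close>)
  have im2: "\<rho> ` {p + 1..p + q} = {p + 1..p + q}"
  proof -
    have "{p + 1..p + q} = {1..p + q} - {1..p}" by auto
    moreover have "\<rho> ` ({1..p + q} - {1..p}) = \<rho> ` {1..p + q} - \<rho> ` {1..p}"
      by (rule image_set_diff[OF permutes_inj[OF p]])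
    ultimately show ?thesis using im permutes_image[OF p] by simp
  qed
  have "\<tau> = (\<lambda>j. if j \<in> {p + 1..p + q} then \<rho> j else j)"
    unfolding \<tau>_def using permutes_not_in[OF p] by (auto simp: fun_eq_iff)
  then have t: "\<tau> permutes {p + 1..p + q}"
    using permutes_if[of \<rho> "{p + 1..p + q}"] im2 permutes_inj_on[OF p] by (simp add: bij_betw_def)
  have "\<rho> j = \<sigma> (\<tau> j)" for j
  proof (cases "j \<in> {1..p}")
    case False
    then have "\<rho> j \<notin> {1..p}" using im inj by (metis imageE)
    with False show ?thesis by (auto simp: \<sigma>_def \<tau>_def)
  qed (auto simp: \<sigma>_def \<tau>_def)
  then have "\<rho> = \<sigma> \<circ> \<tau>" by (simp add: fun_eq_iff)
  then show "\<rho> \<in> {\<sigma> \<circ> \<tau> | \<sigma> \<tau>. \<sigma> permutes {1..p} \<and> \<tau> permutes {p + 1..p + q}}"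
    using s t by blast
next
  fix \<rho> assume "\<rho> \<in> {\<sigma> \<circ> \<tau> | \<sigma> \<tau>. \<sigma> permutes {1..p} \<and> \<tau> permutes {p + 1..p + q}}"
  then obtain \<sigma> \<tau> where r: "\<rho> = \<sigma> \<circ> \<tau>" and s: "\<sigma> permutes {1..p}" and t: "\<tau> permutes {p + 1..p + q}"
    by blast
  have "\<tau> ` {1..p} = {1..p}"
    using permutes_not_in[OF t] image_cong[of "{1..p}" "{1..p}" \<tau> "\<lambda>x. x"] by simp
  then have "\<rho> ` {1..p} = {1..p}"
    using permutes_image[OF s] by (metis image_comp r)
  moreover have "\<sigma> permutes {1..p + q}" "\<tau> permutes {1..p + q}"
    using permutes_subset[OF s] permutes_subset[OF t] by auto
  ultimately show "\<rho> \<in> block_perms p (p + q)"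
    using permutes_compose by (auto simp: block_perms_def r)
qed

lemma Sym_prod_eq: "Sym_prod ty p q = perm_mat ty (p + q) ` block_perms p (p + q)"
  by (simp add: Sym_prod_def block_perms_eq)

lemma subgroup_Sym_prod_GL:
  "subgroup (Sym_prod TYPE('a::field) p q) (GL TYPE('a) (p + q))"
  unfolding Sym_prod_eq
proof (rule subgroup_perm_mat_image)
  fix \<sigma> assume s: "\<sigma> \<in> block_perms p (p + q)"
  then have p: "\<sigma> permutes {1..p + q}" and im: "\<sigma> ` {1..p} = {1..p}"
    by (auto simp: block_perms_def)
  have "Hilbert_Choice.inv \<sigma> ` {1..p} = Hilbert_Choice.inv \<sigma> ` \<sigma> ` {1..p}" using im by simp
  also have "\<dots> = {1..p}" using permutes_inverses(2)[OF p] by (simp add: image_image)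
  finally show "Hilbert_Choice.inv \<sigma> \<in> block_perms p (p + q)"
    using permutes_inv[OF p] by (auto simp: block_perms_def)
next
  fix \<sigma> \<tau> assume "\<sigma> \<in> block_perms p (p + q)" "\<tau> \<in> block_perms p (p + q)"
  then show "\<sigma> \<circ> \<tau> \<in> block_perms p (p + q)"
    unfolding block_perms_def using permutes_compose by (smt (verit) image_comp mem_Collect_eq)
qed (simp_all add: block_perms_def permutes_id)

lemma subgroup_Sym_groupI:
  assumes "subgroup H (GL TYPE('a::field) m)" and "H \<subseteq> Sym TYPE('a) m"
  shows "subgroup H (Sym_group TYPE('a) m)"
  unfolding Sym_group_def
  using group.subgroup_incl[OF group_GL assms(1) subgroup_Sym assms(2)] .

lemma subgroup_Delta_Sym: "subgroup (Delta_Sym TYPE('a::field) n) (Sym_group TYPE('a) (2 * n))"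
  by (rule subgroup_Sym_groupI[OF subgroup_Delta_Sym_GL])
    (auto simp: Delta_Sym_eq Sym_def diagonal_perms_def)

lemma subgroup_Sym_prod: "subgroup (Sym_prod TYPE('a::field) p q) (Sym_group TYPE('a) (p + q))"
  by (rule subgroup_Sym_groupI[OF subgroup_Sym_prod_GL])
    (auto simp: Sym_prod_eq Sym_def block_perms_def)

section \<open>Double cosets of permutations\<close>

text \<open>
  The double coset of \<open>\<sigma>\<close> depends only on the \<open>r\<close>-subset \<open>\<sigma> {1..r}\<close> of
  two copies of \<open>{1..n}\<close> up to the diagonal action; these are its two parts.
\<close>

definition top_set :: "nat \<Rightarrow> nat \<Rightarrow> (nat \<Rightarrow> nat) \<Rightarrow> nat set" where
  "top_set n r \<sigma> = {j \<in> {1..n}. j \<in> \<sigma> ` {1..r}}"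

definition bot_set :: "nat \<Rightarrow> nat \<Rightarrow> (nat \<Rightarrow> nat) \<Rightarrow> nat set" where
  "bot_set n r \<sigma> = {j \<in> {1..n}. n + j \<in> \<sigma> ` {1..r}}"

lemma top_set_subset: "top_set n r \<sigma> \<subseteq> {1..n}" and bot_set_subset: "bot_set n r \<sigma> \<subseteq> {1..n}"
  by (auto simp: top_set_def bot_set_def)

lemma finite_top_set [simp]: "finite (top_set n r \<sigma>)" and finite_bot_set [simp]: "finite (bot_set n r \<sigma>)"
  by (auto simp: top_set_def bot_set_def)

lemma image_eq_top_bot:
  assumes s: "\<sigma> permutes {1..2 * n}" and r: "r \<le> 2 * n"
  shows "\<sigma> ` {1..r} = top_set n r \<sigma> \<union> (+) n ` bot_set n r \<sigma>"
proof -
  have sub: "\<sigma> ` {1..r} \<subseteq> {1..2 * n}"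
    using permutes_image[OF s] r by (metis atLeastatMost_subset_iff image_mono order_refl)
  show ?thesis
  proof (intro equalityI subsetI)
    fix i assume i: "i \<in> \<sigma> ` {1..r}"
    then have "i \<in> {1..2 * n}" using sub by blast
    show "i \<in> top_set n r \<sigma> \<union> (+) n ` bot_set n r \<sigma>"
    proof (cases "i \<le> n")
      case False
      then have "i = n + (i - n)" "i - n \<in> bot_set n r \<sigma>"
        using i \<open>i \<in> {1..2 * n}\<close> by (auto simp: bot_set_def)
      then show ?thesis by blast
    qed (use i \<open>i \<in> {1..2 * n}\<close> in \<open>auto simp: top_set_def\<close>)
  qed (auto simp: top_set_def bot_set_def)
qed

lemma card_top_bot:
  assumes s: "\<sigma> permutes {1..2 * n}" and r: "r \<le> 2 * n"
  shows "card (top_set n r \<sigma>) + card (bot_set n r \<sigma>) = r"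
proof -
  have "r = card (\<sigma> ` {1..r})"
    using card_image[OF permutes_inj_on[OF s]] by simp
  also have "\<dots> = card (top_set n r \<sigma>) + card ((+) n ` bot_set n r \<sigma>)"
    unfolding image_eq_top_bot[OF assms]
    by (rule card_Un_disjoint) (auto simp: top_set_def bot_set_def)
  also have "card ((+) n ` bot_set n r \<sigma>) = card (bot_set n r \<sigma>)"
    by (rule card_image) simp
  finally show ?thesis by simp
qed

text \<open>With \<open>k\<close> and \<open>l\<close> the sizes of the top set and of the overlap,
  the bottom set has \<open>r - k\<close> elements and the union \<open>r - l\<close>. The
  admissibility bounds say that both fit into \<open>{1..n}\<close> and that the overlap is
  contained in each part.\<close>

lemma admissible_top_bot:
  assumes s: "\<sigma> permutes {1..2 * n}" and r: "r \<le> 2 * n"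
  shows "admissible n r (card (top_set n r \<sigma>)) (card (top_set n r \<sigma> \<inter> bot_set n r \<sigma>))"
proof -
  let ?A = "top_set n r \<sigma>" and ?B = "bot_set n r \<sigma>"
  have sum: "card ?A + card ?B = r" by (rule card_top_bot[OF assms])
  have "card ?A \<le> n" "card ?B \<le> n" "card (?A \<union> ?B) \<le> n"
    using card_mono[of "{1..n}"] top_set_subset[of n r \<sigma>] bot_set_subset[of n r \<sigma>] by force+
  moreover have "card (?A \<inter> ?B) \<le> card ?A" "card (?A \<inter> ?B) \<le> card ?B"
    by (auto intro: card_mono)
  moreover have "card (?A \<union> ?B) + card (?A \<inter> ?B) = card ?A + card ?B"
    by (rule card_Un_Int[symmetric]) auto
  ultimately show ?thesis
    using sum unfolding admissible_def by auto
qed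

text \<open>Each pair of subsets cuts \<open>S\<close> into four cells, and the three cardinalities
  determine the sizes of all four. Bijections between corresponding cells are glued to
  \<open>\<delta>\<close>.\<close>

lemma ex_permutes_image2:
  assumes fin: "finite S" and sub: "A \<subseteq> S" "B \<subseteq> S" "A' \<subseteq> S" "B' \<subseteq> S"
    and cA: "card A = card A'" and cB: "card B = card B'" and cI: "card (A \<inter> B) = card (A' \<inter> B')"
  obtains \<delta> where "\<delta> permutes S" "\<delta> ` A = A'" "\<delta> ` B = B'"
proof -
  have fins: "finite A" "finite B" "finite A'" "finite B'"
    using sub fin finite_subset by blast+
  have "card (A \<union> B) = card (A' \<union> B')"
    using card_Un_Int[of A B] card_Un_Int[of A' B'] fins cA cB cI by simp
  then have "card (S - (A \<union> B)) = card (S - (A' \<union> B'))"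
    using fins sub by (simp add: card_Diff_subset)
  moreover have "card (A - B) = card (A' - B')" "card (B - A) = card (B' - A')"
    using fins cA cB cI by (simp_all add: card_Diff_subset_Int Int_commute)
  ultimately obtain f1 f2 f3 f4 where f: "bij_betw f1 (A \<inter> B) (A' \<inter> B')" "bij_betw f2 (A - B) (A' - B')"
      "bij_betw f3 (B - A) (B' - A')" "bij_betw f4 (S - (A \<union> B)) (S - (A' \<union> B'))"
    using finite_same_card_bij[of "A \<inter> B" "A' \<inter> B'"] finite_same_card_bij[of "A - B" "A' - B'"]
      finite_same_card_bij[of "B - A" "B' - A'"] finite_same_card_bij[of "S - (A \<union> B)" "S - (A' \<union> B')"]
      fins fin cI by (metis finite_Diff finite_Int)
  define h where "h = (\<lambda>x. if x \<in> A \<inter> B then f1 x else if x \<in> A then f2 x else if x \<in> B then f3 x else f4 x)"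
  have h: "bij_betw h (A \<inter> B) (A' \<inter> B')" "bij_betw h (A - B) (A' - B')"
      "bij_betw h (B - A) (B' - A')" "bij_betw h (S - (A \<union> B)) (S - (A' \<union> B'))"
    using f bij_betw_cong[of "A \<inter> B" h f1] bij_betw_cong[of "A - B" h f2]
      bij_betw_cong[of "B - A" h f3] bij_betw_cong[of "S - (A \<union> B)" h f4]
    by (simp_all add: h_def)
  have "bij_betw h (A \<inter> B \<union> (A - B)) (A' \<inter> B' \<union> (A' - B'))"
    by (rule bij_betw_combine[OF h(1,2)]) auto
  then have hA: "bij_betw h A A'" by (simp only: Int_Diff_Un)
  have hU: "bij_betw h (A \<union> B) (A' \<union> B')"
    using bij_betw_combine[OF hA h(3)] by auto
  have hS: "bij_betw h S S"
    using bij_betw_combine[OF hU h(4)] sub by (auto simp: Un_absorb1)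
  have hB: "h ` B = B'"
    using bij_betw_combine[OF h(1,3)] by (auto simp: bij_betw_def Int_commute Int_Diff_Un)
  show thesis
  proof (rule that)
    show "(\<lambda>x. if x \<in> S then h x else x) permutes S" by (rule permutes_if[OF hS])
    show "(\<lambda>x. if x \<in> S then h x else x) ` A = A'"
      using hA sub(1) by (auto simp: bij_betw_def subset_iff image_iff)
    show "(\<lambda>x. if x \<in> S then h x else x) ` B = B'"
      using hB sub(2) by (auto simp: subset_iff image_iff)
  qed
qed

lemma diagonal_perms_extend:
  assumes d: "\<delta> permutes {1..n}"
  defines "\<delta>' \<equiv> \<lambda>j. if j \<le> n then \<delta> j else if j \<le> 2 * n then n + \<delta> (j - n) else j"
  shows "\<delta>' \<in> diagonal_perms n"
proof -
  have im: "1 \<le> \<delta> j" "\<delta> j \<le> n" if "1 \<le> j" "j \<le> n" for j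
    using permutes_in_image[OF d, of j] that by simp_all
  have up: "1 \<le> \<delta> (j - n)" "\<delta> (j - n) \<le> n" if "n < j" "j \<le> 2 * n" for j
    using im[of "j - n"] that by simp_all
  \<comment> \<open>The first branch of \<open>\<delta>'\<close> also covers the index 0, which lies
    outside \<open>{1..2 * n}\<close> and must be fixed.\<close>
  have d0: "\<delta> 0 = 0" using permutes_not_in[OF d] by simp
  have inj: "\<delta> i = \<delta> j \<longleftrightarrow> i = j" for i j using permutes_inj[OF d] by (auto simp: inj_def)
  have "inj_on \<delta>' {1..2 * n}"
  proof (rule inj_onI)
    fix i j assume *: "i \<in> {1..2 * n}" "j \<in> {1..2 * n}" "\<delta>' i = \<delta>' j"
    then show "i = j"
      using im[of i] im[of j] up[of i] up[of j]
      by (cases "i \<le> n"; cases "j \<le> n") (auto simp: \<delta>'_def inj)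
  qed
  moreover have "\<delta>' ` {1..2 * n} \<subseteq> {1..2 * n}"
  proof (rule image_subsetI)
    fix j assume "j \<in> {1..2 * n}"
    then show "\<delta>' j \<in> {1..2 * n}"
      using im[of j] up[of j] by (auto simp: \<delta>'_def)
  qed
  ultimately have "bij_betw \<delta>' {1..2 * n} {1..2 * n}"
    by (simp add: bij_betw_def endo_inj_surj)
  then have "\<delta>' permutes {1..2 * n}"
    by (rule bij_imp_permutes) (auto simp: \<delta>'_def d0 not_le)
  then show ?thesis
    using im by (auto simp: diagonal_perms_def \<delta>'_def)
qed

text \<open>Some \<open>\<delta>\<close> in \<open>S_n\<close> matches the top and bottom sets
  simultaneously. Acting diagonally, it makes the images of \<open>{1..r}\<close> agree, and
  permutations with the same image of \<open>{1..r}\<close> differ on the right by an element of the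
  stabilizer.\<close>

lemma ex_diagonal_block_perms:
  assumes s: "\<sigma> permutes {1..2 * n}" and s': "\<sigma>' permutes {1..2 * n}" and r: "r \<le> 2 * n"
    and cA: "card (top_set n r \<sigma>) = card (top_set n r \<sigma>')"
    and cI: "card (top_set n r \<sigma> \<inter> bot_set n r \<sigma>) = card (top_set n r \<sigma>' \<inter> bot_set n r \<sigma>')"
  obtains \<delta> \<tau> where "\<delta> \<in> diagonal_perms n" "\<tau> \<in> block_perms r (2 * n)" "\<sigma>' = \<delta> \<circ> \<sigma> \<circ> \<tau>"
proof -
  have cB: "card (bot_set n r \<sigma>) = card (bot_set n r \<sigma>')"
    using card_top_bot[OF s r] card_top_bot[OF s' r] cA by simp
  obtain \<delta> where d: "\<delta> permutes {1..n}" and dA: "\<delta> ` top_set n r \<sigma> = top_set n r \<sigma>'"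
    and dB: "\<delta> ` bot_set n r \<sigma> = bot_set n r \<sigma>'"
    using ex_permutes_image2[OF _ top_set_subset bot_set_subset top_set_subset bot_set_subset cA cB cI]
    by auto
  define \<delta>' where "\<delta>' = (\<lambda>j. if j \<le> n then \<delta> j else if j \<le> 2 * n then n + \<delta> (j - n) else j)"
  have d': "\<delta>' \<in> diagonal_perms n"
    unfolding \<delta>'_def by (rule diagonal_perms_extend[OF d])
  then have p: "\<delta>' permutes {1..2 * n}" by (rule diagonal_perms_permutes)
  have "\<delta>' ` top_set n r \<sigma> = \<delta> ` top_set n r \<sigma>"
    using top_set_subset[of n r \<sigma>] by (intro image_cong) (auto simp: \<delta>'_def)
  moreover have "\<delta>' ` (+) n ` bot_set n r \<sigma> = (+) n ` \<delta> ` bot_set n r \<sigma>"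
    unfolding image_image using bot_set_subset[of n r \<sigma>] by (intro image_cong) (auto simp: \<delta>'_def)
  ultimately have im: "\<delta>' ` \<sigma> ` {1..r} = \<sigma>' ` {1..r}"
    unfolding image_eq_top_bot[OF s r] image_eq_top_bot[OF s' r] image_Un by (simp only: dA dB)
  define \<tau> where "\<tau> = Hilbert_Choice.inv (\<delta>' \<circ> \<sigma>) \<circ> \<sigma>'"
  have ds: "\<delta>' \<circ> \<sigma> permutes {1..2 * n}" by (rule permutes_compose[OF s p])
  have "\<tau> permutes {1..2 * n}"
    unfolding \<tau>_def by (rule permutes_compose[OF s' permutes_inv[OF ds]])
  moreover have "\<tau> ` {1..r} = Hilbert_Choice.inv (\<delta>' \<circ> \<sigma>) ` (\<delta>' \<circ> \<sigma>) ` {1..r}"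
    unfolding \<tau>_def by (metis im image_comp)
  then have "\<tau> ` {1..r} = {1..r}"
    using permutes_inj[OF ds] by (simp only: image_inv_f_f)
  ultimately have "\<tau> \<in> block_perms r (2 * n)" by (simp add: block_perms_def)
  moreover have "\<sigma>' = \<delta>' \<circ> \<sigma> \<circ> \<tau>"
    unfolding \<tau>_def using permutes_inv_o(1)[OF ds] by (metis comp_assoc id_comp)
  ultimately show thesis using that d' by blast
qed

section \<open>The representatives as permutation matrices\<close>

text \<open>The six branches are the block columns of \<open>w_mat\<close> from left to right, each
  giving the row reached by column \<open>j\<close>. The first and last branches also fix 0 and
  everything beyond \<open>2 * n\<close>.\<close>

definition w_perm :: "nat \<Rightarrow> nat \<Rightarrow> nat \<Rightarrow> nat \<Rightarrow> nat \<Rightarrow> nat" where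
  "w_perm n r k l j =
     (if j \<le> k then j
      else if j \<le> k + l then n + (j - k)
      else if j \<le> r then n + (j - l)
      else if j \<le> r + (n - k) then k + (j - r)
      else if j \<le> r + (n - l) then l + k + (j - r)
      else j)"

context
  fixes n r k l :: nat
  assumes r: "r < 2 * n" and adm: "admissible n r k l"
begin

text \<open>Admissibility is rewritten without truncated subtraction, ready for linear
  arithmetic.\<close>

lemma admissible_bounds:
  "r \<le> n + k" "k \<le> r" "k \<le> n" "r \<le> n + l" "l \<le> k" "k + l \<le> r"
  using adm by (auto simp: admissible_def)

lemma w_perm_permutes: "w_perm n r k l permutes {1..2 * n}"
proof -
  note b = admissible_bounds
  have "inj_on (w_perm n r k l) {1..2 * n}"
    by (rule inj_onI) (use b r in \<open>auto simp: w_perm_def split: if_splits\<close>)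
  moreover have "w_perm n r k l ` {1..2 * n} \<subseteq> {1..2 * n}"
    using b r by (auto simp: w_perm_def)
  ultimately have "bij_betw (w_perm n r k l) {1..2 * n} {1..2 * n}"
    by (simp add: bij_betw_def endo_inj_surj)
  then show ?thesis
    by (rule bij_imp_permutes) (use b r in \<open>auto simp: w_perm_def\<close>)
qed

lemma top_set_w_perm: "top_set n r (w_perm n r k l) = {1..k}"
  using admissible_bounds r by (fastforce simp: top_set_def w_perm_def image_iff)

text \<open>The second and third block columns are those among the first \<open>r\<close> columns
  that land in the lower half. The rows left free between their images are filled by the fifth block
  column.\<close>

lemma bot_set_w_perm: "bot_set n r (w_perm n r k l) = {1..l} \<union> {k + 1..r - l}"
proof (intro equalityI subsetI)
  fix j assume "j \<in> bot_set n r (w_perm n r k l)"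
  then obtain i where "1 \<le> j" "j \<le> n" "i \<in> {1..r}" "n + j = w_perm n r k l i"
    by (auto simp: bot_set_def)
  then show "j \<in> {1..l} \<union> {k + 1..r - l}"
    using admissible_bounds r by (auto simp: w_perm_def split: if_splits)
next
  fix j assume j: "j \<in> {1..l} \<union> {k + 1..r - l}"
  \<comment> \<open>The inverse of the second and third branches of \<open>w_perm\<close>.\<close>
  define i where "i = (if j \<le> l then k + j else j + l)"
  have "i \<in> {1..r}" "n + j = w_perm n r k l i" "j \<in> {1..n}"
    using admissible_bounds r j by (auto simp: i_def w_perm_def)
  then show "j \<in> bot_set n r (w_perm n r k l)"
    unfolding bot_set_def by blast
qed

lemma card_top_set_w_perm: "card (top_set n r (w_perm n r k l)) = k"
  by (simp add: top_set_w_perm)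

lemma card_top_bot_w_perm:
  "card (top_set n r (w_perm n r k l) \<inter> bot_set n r (w_perm n r k l)) = l"
proof -
  have "{1..k} \<inter> ({1..l} \<union> {k + 1..r - l}) = {1..l}"
    using admissible_bounds by auto
  then show ?thesis by (simp add: top_set_w_perm bot_set_w_perm)
qed

end

section \<open>Entries of the block matrices\<close>

lemma beside_dim: "dim_row (beside A B) = dim_row A" "dim_col (beside A B) = dim_col A + dim_col B"
  by (simp_all add: beside_def)

lemma beside_index:
  "i < dim_row A \<Longrightarrow> j < dim_col A + dim_col B \<Longrightarrow>
     beside A B $$ (i, j) = (if j < dim_col A then A $$ (i, j) else B $$ (i, j - dim_col A))"
  by (simp add: beside_def)

lemma append_rows_dim:
  "dim_row (A @\<^sub>r B) = dim_row A + dim_row B" "dim_col (A @\<^sub>r B) = dim_col A"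
  by (simp_all add: append_rows_def)

lemma append_rows_index:
  "i < dim_row A + dim_row B \<Longrightarrow> j < dim_col A \<Longrightarrow>
     (A @\<^sub>r B) $$ (i, j) = (if i < dim_row A then A $$ (i, j) else B $$ (i - dim_row A, j))"
  by (simp add: append_rows_def)

text \<open>Writing an index as a block offset plus a position lets block entries be evaluated
  without subtractions.\<close>

lemma six_blocks_cases:
  fixes i :: nat
  assumes "i < a + b + c + d + e + f"
  obtains "i < a" | x where "i = a + x" "x < b" | x where "i = a + b + x" "x < c"
    | x where "i = a + b + c + x" "x < d" | x where "i = a + b + c + d + x" "x < e"
    | x where "i = a + b + c + d + e + x" "x < f"
proof -
  consider "i < a" | "a \<le> i" "i < a + b" | "a + b \<le> i" "i < a + b + c"
    | "a + b + c \<le> i" "i < a + b + c + d" | "a + b + c + d \<le> i" "i < a + b + c + d + e"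
    | "a + b + c + d + e \<le> i"
    by linarith
  then show thesis
    by cases (use assms in \<open>auto simp: le_iff_add intro: that\<close>)
qed

lemma w_mat_eq_perm_mat:
  assumes r: "r < 2 * n" and adm: "admissible n r k l"
  shows "w_mat TYPE('a::field) n r k l = perm_mat TYPE('a) (2 * n) (w_perm n r k l)"
proof -
  note b = admissible_bounds[OF assms]
  \<comment> \<open>Block sizes as free parameters, so that no natural-number subtraction remains.\<close>
  define p q s where "p = k - l" and "q = r - (k + l)" and "s = n + l - r"
  have k: "k = l + p" and rr: "r = l + p + l + q" and n: "n = l + p + q + s"
    using b by (auto simp: p_def q_def s_def)
  have sub: "n - k = q + s" "k - l = p" "r - (k + l) = q" "n + l - r = s" "n - l = p + q + s"
    by (simp_all add: k rr n)
  note simps = w_mat_def block_mat_def Let_def beside_dim append_rows_dim sub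
  \<comment> \<open>The conditions become strict inequalities because the matrix column
    \<open>j\<close> counts from zero.\<close>
  have w: "w_perm n r k l (Suc j) =
     (if j < k then Suc j
      else if j < k + l then n + (Suc j - k)
      else if j < r then n + (Suc j - l)
      else if j < r + (q + s) then k + (Suc j - r)
      else if j < r + (p + q + s) then l + k + (Suc j - r)
      else Suc j)" for j
    by (auto simp: w_perm_def sub)
  show ?thesis
  proof (rule eq_matI)
    show "dim_row (w_mat TYPE('a) n r k l) = dim_row (perm_mat TYPE('a) (2 * n) (w_perm n r k l))"
      by (simp add: simps) (simp add: k n)
    show "dim_col (w_mat TYPE('a) n r k l) = dim_col (perm_mat TYPE('a) (2 * n) (w_perm n r k l))"
      by (simp add: simps) (simp add: k n)
  next
    fix i j assume "i < dim_row (perm_mat TYPE('a) (2 * n) (w_perm n r k l))"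
      "j < dim_col (perm_mat TYPE('a) (2 * n) (w_perm n r k l))"
    then have i: "i < 2 * n" and j: "j < 2 * n" by auto
    \<comment> \<open>The summands are the block heights and block widths in the order in which they
      occur in \<open>w_mat\<close>; splitting both indices leaves 36 cases.\<close>
    have i': "i < (l + p) + (q + s) + l + p + q + s" and j': "j < (l + p) + l + q + (q + s) + p + s"
      using i j by (simp_all add: n)
    have "w_mat TYPE('a) n r k l $$ (i, j) = (if Suc i = w_perm n r k l (Suc j) then 1 else 0)"
      unfolding w unfolding simps unfolding k rr n
      by (cases rule: six_blocks_cases[OF i']; cases rule: six_blocks_cases[OF j'])
        (simp_all add: append_rows_index beside_index beside_dim append_rows_dim)
    then show "w_mat TYPE('a) n r k l $$ (i, j) = perm_mat TYPE('a) (2 * n) (w_perm n r k l) $$ (i, j)"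
      using i j by simp
  qed
qed

section \<open>Matrices acting on finitely supported functions\<close>

text \<open>
  Column vectors of length \<open>m\<close> are functions on \<open>nat\<close> vanishing outside \<open>{1..m}\<close>, so that
  vectors of all lengths live in one type and indices agree with those of permutations.
\<close>

definition fscale :: "'a::field \<Rightarrow> (nat \<Rightarrow> 'a) \<Rightarrow> nat \<Rightarrow> 'a" where
  "fscale c f = (\<lambda>i. c * f i)"

interpretation fun_vs: vector_space "fscale :: 'a::field \<Rightarrow> _"
  by unfold_locales (auto simp: fscale_def fun_eq_iff algebra_simps)

lemma sum_fun_apply: "(\<Sum>i\<in>A. f i) x = (\<Sum>i\<in>A. f i x :: 'a::comm_monoid_add)"
  by (induction A rule: infinite_finite_induct) auto

definition unit_fun :: "nat \<Rightarrow> nat \<Rightarrow> 'a::field" where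
  "unit_fun i = (\<lambda>j. if j = i then 1 else 0)"

definition fun_space :: "nat \<Rightarrow> (nat \<Rightarrow> 'a::field) set" where
  "fun_space m = {f. \<forall>i. i \<notin> {1..m} \<longrightarrow> f i = 0}"

lemma fun_space_subspace: "fun_vs.subspace (fun_space m)"
  by (auto simp: fun_vs.subspace_def fun_space_def fscale_def)

lemma inj_unit_fun: "inj (unit_fun :: nat \<Rightarrow> nat \<Rightarrow> 'a::field)"
proof (rule injI)
  fix i j assume "(unit_fun i :: nat \<Rightarrow> 'a) = unit_fun j"
  then have "(unit_fun i :: nat \<Rightarrow> 'a) i = unit_fun j i" by simp
  then show "i = j" by (simp add: unit_fun_def split: if_splits)
qed

lemma card_unit_fun_image: "card (unit_fun ` A :: (nat \<Rightarrow> 'a::field) set) = card A"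
  by (rule card_image) (use inj_unit_fun in \<open>auto simp: inj_on_def inj_def\<close>)

lemma span_unit_fun: "fun_vs.span (unit_fun ` {1..m}) = (fun_space m :: (nat \<Rightarrow> 'a::field) set)"
proof
  show "fun_vs.span (unit_fun ` {1..m}) \<subseteq> (fun_space m :: (nat \<Rightarrow> 'a) set)"
    by (rule fun_vs.span_minimal[OF _ fun_space_subspace]) (auto simp: unit_fun_def fun_space_def)
  show "(fun_space m :: (nat \<Rightarrow> 'a) set) \<subseteq> fun_vs.span (unit_fun ` {1..m})"
  proof
    fix f :: "nat \<Rightarrow> 'a" assume f: "f \<in> fun_space m"
    have "f x = (\<Sum>i\<in>{1..m}. fscale (f i) (unit_fun i)) x" for x
    proof -
      have "(\<Sum>i\<in>{1..m}. fscale (f i) (unit_fun i)) x = (\<Sum>i\<in>{1..m}. if i = x then f x else 0)"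
        unfolding sum_fun_apply by (intro sum.cong) (auto simp: fscale_def unit_fun_def)
      then show ?thesis using f by (simp add: fun_space_def)
    qed
    then have "f = (\<Sum>i\<in>{1..m}. fscale (f i) (unit_fun i))" by (rule ext)
    also have "\<dots> \<in> fun_vs.span (unit_fun ` {1..m})"
      by (intro fun_vs.span_sum fun_vs.span_scale fun_vs.span_base imageI)
    finally show "f \<in> fun_vs.span (unit_fun ` {1..m})" .
  qed
qed

lemma independent_unit_fun: "fun_vs.independent (unit_fun ` A :: (nat \<Rightarrow> 'a::field) set)"
  unfolding fun_vs.dependent_def
proof (rule notI, clarify)
  fix a assume a: "(unit_fun a :: nat \<Rightarrow> 'a) \<in> fun_vs.span (unit_fun ` A - {unit_fun a})"
  \<comment> \<open>The hyperplane where coordinate \<open>a\<close> vanishes contains all the other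
    unit vectors but not \<open>unit_fun a\<close>.\<close>
  have "fun_vs.subspace {f :: nat \<Rightarrow> 'a. f a = 0}"
    by (auto simp: fun_vs.subspace_def fscale_def)
  then have "fun_vs.span (unit_fun ` A - {unit_fun a :: nat \<Rightarrow> 'a}) \<subseteq> {f. f a = 0}"
    by (intro fun_vs.span_minimal) (auto simp: unit_fun_def)
  with a show False by (auto simp: unit_fun_def)
qed

text \<open>Matrix times column vector. The decrements translate one-based coordinates into
  zero-based matrix indices, and the value 0 elsewhere keeps the result in
  \<open>fun_space (dim_row M)\<close>.\<close>

definition app :: "'a::field mat \<Rightarrow> (nat \<Rightarrow> 'a) \<Rightarrow> nat \<Rightarrow> 'a" where
  "app M f = (\<lambda>i. if i \<in> {1..dim_row M} then \<Sum>j\<in>{1..dim_col M}. M $$ (i - 1, j - 1) * f j else 0)"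

text \<open>
  The nilpotent endomorphism \<open>e\<^sub>n\<^sub>+\<^sub>j \<mapsto> e\<^sub>j\<close>, \<open>e\<^sub>j \<mapsto> 0\<close> (for \<open>1 \<le> j \<le> n\<close>), whose
  centralizer is the Shalika subgroup.
\<close>

definition shift :: "nat \<Rightarrow> (nat \<Rightarrow> 'a::field) \<Rightarrow> nat \<Rightarrow> 'a" where
  "shift n f = (\<lambda>i. if i \<in> {1..n} then f (n + i) else 0)"

interpretation app: module_hom fscale fscale "app M" for M :: "'a::field mat"
  by unfold_locales
    (auto simp: app_def fscale_def fun_eq_iff algebra_simps sum.distrib sum_distrib_left)

interpretation shift: module_hom fscale fscale "shift n :: (nat \<Rightarrow> 'a::field) \<Rightarrow> _" for n
  by unfold_locales (auto simp: shift_def fscale_def fun_eq_iff)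

lemma app_in_fun_space: "app M f \<in> fun_space (dim_row M)"
  by (simp add: app_def fun_space_def)

lemma app_unit_fun:
  assumes "j \<in> {1..dim_col M}"
  shows "app M (unit_fun j) = (\<lambda>i. if i \<in> {1..dim_row M} then M $$ (i - 1, j - 1) else 0)"
proof (rule ext)
  fix i
  have "(\<Sum>k\<in>{1..dim_col M}. M $$ (i - 1, k - 1) * unit_fun j k)
      = (\<Sum>k\<in>{1..dim_col M}. if k = j then M $$ (i - 1, j - 1) else 0)"
    by (intro sum.cong) (auto simp: unit_fun_def)
  then show "app M (unit_fun j) i = (if i \<in> {1..dim_row M} then M $$ (i - 1, j - 1) else 0)"
    using assms by (simp add: app_def)
qed

lemma app_mult:
  assumes A: "A \<in> carrier_mat a b" and B: "B \<in> carrier_mat b c"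
  shows "app (A * B) f = app A (app B f)"
proof (rule ext)
  fix i
  show "app (A * B) f i = app A (app B f) i"
  proof (cases "i \<in> {1..a}")
    case True
    have "app (A * B) f i = (\<Sum>j\<in>{1..c}. (\<Sum>k\<in>{1..b}. A $$ (i - 1, k - 1) * B $$ (k - 1, j - 1)) * f j)"
    proof -
      have "(A * B) $$ (i - 1, j - 1) = (\<Sum>k\<in>{1..b}. A $$ (i - 1, k - 1) * B $$ (k - 1, j - 1))"
        if "j \<in> {1..c}" for j
      proof -
        have "(A * B) $$ (i - 1, j - 1) = (\<Sum>k\<in>{0..<b}. A $$ (i - 1, k) * B $$ (k, j - 1))"
          using A B True that by (auto simp: scalar_prod_def)
        also have "\<dots> = (\<Sum>k\<in>{1..b}. A $$ (i - 1, k - 1) * B $$ (k - 1, j - 1))"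
          by (rule sum.reindex_bij_witness[of _ "\<lambda>k. k - 1" Suc]) auto
        finally show ?thesis .
      qed
      then show ?thesis using A B True by (simp add: app_def)
    qed
    also have "\<dots> = (\<Sum>k\<in>{1..b}. \<Sum>j\<in>{1..c}. A $$ (i - 1, k - 1) * B $$ (k - 1, j - 1) * f j)"
      unfolding sum_distrib_right by (rule sum.swap)
    also have "\<dots> = app A (app B f) i"
      using A B True by (simp add: app_def sum_distrib_left mult.assoc)
    finally show ?thesis .
  qed (use A B in \<open>auto simp: app_def\<close>)
qed

lemma app_one:
  assumes "f \<in> fun_space m"
  shows "app (1\<^sub>m m) f = f"
proof (rule ext)
  fix i
  have "(\<Sum>j\<in>{1..m}. 1\<^sub>m m $$ (i - 1, j - 1) * f j) = (\<Sum>j\<in>{1..m}. if j = i then f i else 0)" if "i \<in> {1..m}"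
    using that by (intro sum.cong) auto
  then show "app (1\<^sub>m m) f i = f i"
    using assms by (auto simp: app_def fun_space_def)
qed

lemma app_perm_mat:
  assumes s: "\<sigma> permutes {1..m}" and j: "j \<in> {1..m}"
  shows "app (perm_mat TYPE('a::field) m \<sigma>) (unit_fun j) = unit_fun (\<sigma> j)"
proof -
  have "\<sigma> j \<in> {1..m}" using permutes_in_image[OF s] j by simp
  then show ?thesis
    using j by (subst app_unit_fun) (auto simp: unit_fun_def fun_eq_iff)
qed

lemma mat_eqI_app:
  assumes A: "A \<in> carrier_mat m k" and B: "B \<in> carrier_mat m k"
    and eq: "\<And>j. j \<in> {1..k} \<Longrightarrow> app A (unit_fun j) = app B (unit_fun j)"
  shows "A = B"
proof (rule eq_matI)
  fix i j assume "i < dim_row B" "j < dim_col B"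
  then have "Suc i \<in> {1..m}" "Suc j \<in> {1..k}" using B by auto
  then show "A $$ (i, j) = B $$ (i, j)"
    using fun_cong[OF eq[of "Suc j"], of "Suc i"] A B by (simp add: app_unit_fun)
qed (use A B in auto)

lemma unit_fun_in_fun_space: "j \<in> {1..m} \<Longrightarrow> unit_fun j \<in> fun_space m"
  by (auto simp: unit_fun_def fun_space_def)

text \<open>If the columns span, each unit vector has a preimage; the matrix \<open>B\<close> with
  these preimages as columns is a right inverse.\<close>

lemma GL_if_span:
  fixes A :: "'a::field mat"
  assumes A: "A \<in> carrier_mat m m" and span: "fun_space m \<subseteq> fun_vs.span (app A ` unit_fun ` {1..m})"
  shows "A \<in> carrier (GL TYPE('a) m)"
proof -
  have "\<exists>h \<in> fun_space m. app A h = unit_fun j" if "j \<in> {1..m}" for j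
    using span unit_fun_in_fun_space[OF that, where ?'a = 'a]
    unfolding app.span_image span_unit_fun by (metis imageE subsetD)
  then obtain h where h: "h j \<in> fun_space m" "app A (h j) = unit_fun j" if "j \<in> {1..m}" for j
    by metis
  define B where "B = mat m m (\<lambda>(i, j). h (Suc j) (Suc i))"
  have B: "B \<in> carrier_mat m m" by (simp add: B_def)
  have "app B (unit_fun j) = h j" if "j \<in> {1..m}" for j
    using h(1)[OF that] that by (subst app_unit_fun) (auto simp: B_def fun_space_def fun_eq_iff)
  then have "app (A * B) (unit_fun j) = app (1\<^sub>m m) (unit_fun j)" if "j \<in> {1..m}" for j
    using that h(2)[OF that] by (simp add: app_mult[OF A B] app_one unit_fun_in_fun_space)
  then have "A * B = 1\<^sub>m m"
    using A B by (intro mat_eqI_app[of _ m m]) auto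
  then show ?thesis using A B by (auto simp: GL_carrier_iff)
qed

section \<open>The Shalika and parabolic subgroups\<close>

text \<open>The upper right block of the product cancels because \<open>g1 * h1 = 1\<close>. The
  explicit form shows that inverses stay block upper triangular and, when \<open>g1 = g2\<close> and
  \<open>h1 = h2\<close>, keep equal diagonal blocks.\<close>

lemma block_upper_inverse:
  fixes g1 :: "'a::field mat"
  assumes g1: "g1 \<in> carrier_mat p p" "h1 \<in> carrier_mat p p" "g1 * h1 = 1\<^sub>m p"
    and g2: "g2 \<in> carrier_mat q q" "h2 \<in> carrier_mat q q" "g2 * h2 = 1\<^sub>m q"
    and x: "x \<in> carrier_mat p q"
  shows "four_block_mat g1 x (0\<^sub>m q p) g2 * four_block_mat h1 (- (h1 * x * h2)) (0\<^sub>m q p) h2 = 1\<^sub>m (p + q)"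
proof -
  have "g1 * (- (h1 * x * h2)) = - (g1 * (h1 * (x * h2)))"
    using g1 g2 x by simp
  also have "g1 * (h1 * (x * h2)) = (g1 * h1) * (x * h2)"
    by (rule assoc_mult_mat[symmetric]) (use g1 g2 x in auto)
  also have "\<dots> = x * h2"
    using g1 g2 x by simp
  finally have e: "g1 * (- (h1 * x * h2)) + x * h2 = 0\<^sub>m p q"
    using g1 g2 x by (simp add: uminus_l_inv_mat)
  have "- 0\<^sub>m q q = (0\<^sub>m q q :: 'a mat)" by (rule eq_matI) auto
  then show ?thesis
    by (subst mult_four_block_mat[of _ p p _ q _ q _ _ p _ q]) (use g1 g2 x e in simp_all)
qed

text \<open>The determinant is the product of those of the diagonal blocks, so invertibility passes
  from \<open>M\<close> to both blocks.\<close>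

lemma block_upper_GL:
  fixes M :: "'a::field mat"
  assumes M: "M \<in> carrier (GL TYPE('a) (p + q))"
    and z: "\<And>i j. i < q \<Longrightarrow> j < p \<Longrightarrow> M $$ (p + i, j) = 0"
  obtains g1 x g2 where "M = four_block_mat g1 x (0\<^sub>m q p) g2"
    "g1 \<in> carrier (GL TYPE('a) p)" "x \<in> carrier_mat p q" "g2 \<in> carrier (GL TYPE('a) q)"
proof -
  define g1 where "g1 = mat p p (\<lambda>(i, j). M $$ (i, j))"
  define x where "x = mat p q (\<lambda>(i, j). M $$ (i, p + j))"
  define g2 where "g2 = mat q q (\<lambda>(i, j). M $$ (p + i, p + j))"
  have Mc: "M \<in> carrier_mat (p + q) (p + q)" and "det M \<noteq> 0"
    using M by (auto simp: GL_iff_det)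
  have c: "g1 \<in> carrier_mat p p" "x \<in> carrier_mat p q" "g2 \<in> carrier_mat q q"
    by (simp_all add: g1_def x_def g2_def)
  have eq: "M = four_block_mat g1 x (0\<^sub>m q p) g2"
  proof (rule eq_matI)
    fix i j assume "i < dim_row (four_block_mat g1 x (0\<^sub>m q p) g2)"
      "j < dim_col (four_block_mat g1 x (0\<^sub>m q p) g2)"
    then have "i < p + q" "j < p + q" using c by auto
    then show "M $$ (i, j) = four_block_mat g1 x (0\<^sub>m q p) g2 $$ (i, j)"
      using z[of "i - p" j] by (auto simp: g1_def x_def g2_def)
  qed (use c Mc in auto)
  have "det M = det g1 * det g2"
    unfolding eq by (rule det_four_block_mat_lower_left_zero[OF c(1,2) refl c(3)])
  then show thesis
    using that[OF eq] c \<open>det M \<noteq> 0\<close> by (auto simp: GL_iff_det)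
qed

lemma block_upper_in_GL:
  fixes g1 :: "'a::field mat"
  assumes "g1 \<in> carrier (GL TYPE('a) p)" "x \<in> carrier_mat p q" "g2 \<in> carrier (GL TYPE('a) q)"
  shows "four_block_mat g1 x (0\<^sub>m q p) g2 \<in> carrier (GL TYPE('a) (p + q))"
  using assms det_four_block_mat_lower_left_zero[of g1 p x q "0\<^sub>m q p" g2]
  by (auto simp: GL_iff_det)

lemma parabolic_iff:
  fixes M :: "'a::field mat"
  shows "M \<in> parabolic TYPE('a) p q \<longleftrightarrow>
    M \<in> carrier (GL TYPE('a) (p + q)) \<and> (\<forall>i<q. \<forall>j<p. M $$ (p + i, j) = 0)"
proof
  assume "M \<in> parabolic TYPE('a) p q"
  then obtain g1 g2 x where g: "g1 \<in> carrier (GL TYPE('a) p)" "g2 \<in> carrier (GL TYPE('a) q)"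
    and x: "x \<in> carrier_mat p q" and M: "M = four_block_mat g1 x (0\<^sub>m q p) g2"
    by (auto simp: parabolic_def)
  then show "M \<in> carrier (GL TYPE('a) (p + q)) \<and> (\<forall>i<q. \<forall>j<p. M $$ (p + i, j) = 0)"
    using block_upper_in_GL[OF g(1) x g(2)] GL_carrierD[OF g(1)] GL_carrierD[OF g(2)] by auto
next
  assume *: "M \<in> carrier (GL TYPE('a) (p + q)) \<and> (\<forall>i<q. \<forall>j<p. M $$ (p + i, j) = 0)"
  obtain g1 x g2 where "M = four_block_mat g1 x (0\<^sub>m q p) g2"
    "g1 \<in> carrier (GL TYPE('a) p)" "x \<in> carrier_mat p q" "g2 \<in> carrier (GL TYPE('a) q)"
    by (rule block_upper_GL[of M p q]) (use * in auto)
  then show "M \<in> parabolic TYPE('a) p q"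
    by (auto simp: parabolic_def)
qed

text \<open>Membership becomes a condition on entries, which suits permutation matrices and the
  comparison with \<open>shift\<close>.\<close>

lemma shalika_iff:
  fixes M :: "'a::field mat"
  shows "M \<in> shalika TYPE('a) n \<longleftrightarrow> M \<in> carrier (GL TYPE('a) (2 * n)) \<and>
    (\<forall>i<n. \<forall>j<n. M $$ (n + i, j) = 0 \<and> M $$ (n + i, n + j) = M $$ (i, j))"
proof
  assume "M \<in> shalika TYPE('a) n"
  then obtain g x where g: "g \<in> carrier (GL TYPE('a) n)" and x: "x \<in> carrier_mat n n"
    and M: "M = four_block_mat g x (0\<^sub>m n n) g" by (auto simp: shalika_def)
  then show "M \<in> carrier (GL TYPE('a) (2 * n)) \<and>
    (\<forall>i<n. \<forall>j<n. M $$ (n + i, j) = 0 \<and> M $$ (n + i, n + j) = M $$ (i, j))"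
    using block_upper_in_GL[OF g x g] GL_carrierD[OF g] by (auto simp: mult_2)
next
  assume *: "M \<in> carrier (GL TYPE('a) (2 * n)) \<and>
    (\<forall>i<n. \<forall>j<n. M $$ (n + i, j) = 0 \<and> M $$ (n + i, n + j) = M $$ (i, j))"
  then obtain g1 x g2 where M: "M = four_block_mat g1 x (0\<^sub>m n n) g2"
    and g: "g1 \<in> carrier (GL TYPE('a) n)" "g2 \<in> carrier (GL TYPE('a) n)" and x: "x \<in> carrier_mat n n"
    by (metis block_upper_GL mult_2)
  have "g1 = g2"
  proof (rule eq_matI)
    fix i j assume "i < dim_row g2" "j < dim_col g2"
    then have ij: "i < n" "j < n" using GL_carrierD[OF g(2)] by auto
    then have "M $$ (n + i, n + j) = M $$ (i, j)" using * by blast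
    then show "g1 $$ (i, j) = g2 $$ (i, j)"
      using ij GL_carrierD[OF g(1)] GL_carrierD[OF g(2)] by (simp add: M)
  qed (use GL_carrierD[OF g(1)] GL_carrierD[OF g(2)] in auto)
  then show "M \<in> shalika TYPE('a) n" using M g x by (auto simp: shalika_def)
qed

lemma parabolic_subgroup: "subgroup (parabolic TYPE('a::field) p q) (GL TYPE('a) (p + q))"
proof -
  interpret group "GL TYPE('a) (p + q)" by (rule group_GL)
  have one: "1\<^sub>m (p + q) \<in> parabolic TYPE('a) p q"
    using one_closed by (simp add: parabolic_iff)
  show ?thesis
  proof (rule subgroupI)
    show "parabolic TYPE('a) p q \<subseteq> carrier (GL TYPE('a) (p + q))"
      by (auto simp: parabolic_iff)
    show "parabolic TYPE('a) p q \<noteq> {}" using one by blast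
  next
    fix M assume M: "M \<in> parabolic TYPE('a) p q"
    then obtain g1 g2 x where g: "g1 \<in> carrier (GL TYPE('a) p)" "g2 \<in> carrier (GL TYPE('a) q)"
      and x: "x \<in> carrier_mat p q" and Me: "M = four_block_mat g1 x (0\<^sub>m q p) g2"
      by (auto simp: parabolic_def)
    obtain h1 where h1: "h1 \<in> carrier (GL TYPE('a) p)" "g1 * h1 = 1\<^sub>m p" by (rule GL_inv[OF g(1)])
    obtain h2 where h2: "h2 \<in> carrier (GL TYPE('a) q)" "g2 * h2 = 1\<^sub>m q" by (rule GL_inv[OF g(2)])
    let ?N = "four_block_mat h1 (- (h1 * x * h2)) (0\<^sub>m q p) h2"
    note car = GL_carrierD[OF g(1)] GL_carrierD[OF g(2)] GL_carrierD[OF h1(1)] GL_carrierD[OF h2(1)] x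
    have N: "?N \<in> parabolic TYPE('a) p q"
      unfolding parabolic_def using h1(1) h2(1) car by (auto intro!: exI)
    have "M * ?N = 1\<^sub>m (p + q)"
      unfolding Me by (rule block_upper_inverse) (use car h1 h2 in auto)
    then have "?N * M = 1\<^sub>m (p + q)"
      using mat_mult_left_right_inverse[of M "p + q" ?N] M N GL_carrierD unfolding parabolic_iff by blast
    then have "inv\<^bsub>GL TYPE('a) (p + q)\<^esub> M = ?N"
      using M N by (intro inv_equality) (auto simp: parabolic_iff)
    then show "inv\<^bsub>GL TYPE('a) (p + q)\<^esub> M \<in> parabolic TYPE('a) p q" using N by simp
  next
    fix M M' assume M: "M \<in> parabolic TYPE('a) p q" and M': "M' \<in> parabolic TYPE('a) p q"
    then obtain g1 g2 x where g: "g1 \<in> carrier (GL TYPE('a) p)" "g2 \<in> carrier (GL TYPE('a) q)"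
      and x: "x \<in> carrier_mat p q" and Me: "M = four_block_mat g1 x (0\<^sub>m q p) g2"
      by (auto simp: parabolic_def)
    obtain h1 h2 y where h: "h1 \<in> carrier (GL TYPE('a) p)" "h2 \<in> carrier (GL TYPE('a) q)"
      and y: "y \<in> carrier_mat p q" and M'e: "M' = four_block_mat h1 y (0\<^sub>m q p) h2"
      using M' by (auto simp: parabolic_def)
    note car = GL_carrierD[OF g(1)] GL_carrierD[OF g(2)] GL_carrierD[OF h(1)] GL_carrierD[OF h(2)] x y
    have "M * M' = four_block_mat (g1 * h1) (g1 * y + x * h2) (0\<^sub>m q p) (g2 * h2)"
      unfolding Me M'e
      by (subst mult_four_block_mat[of _ p p _ q _ q _ _ p _ q]) (use car in simp_all)
    moreover have "g1 * h1 \<in> carrier (GL TYPE('a) p)" "g2 * h2 \<in> carrier (GL TYPE('a) q)"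
      using group.subgroup_self[OF group_GL] subgroup.m_closed g h GL_mult by metis+
    moreover have "g1 * y + x * h2 \<in> carrier_mat p q" using car by simp
    ultimately show "M \<otimes>\<^bsub>GL TYPE('a) (p + q)\<^esub> M' \<in> parabolic TYPE('a) p q"
      unfolding parabolic_def by auto
  qed
qed

lemma shalika_subgroup: "subgroup (shalika TYPE('a::field) n) (GL TYPE('a) (2 * n))"
proof -
  interpret group "GL TYPE('a) (2 * n)" by (rule group_GL)
  have one: "1\<^sub>m (2 * n) \<in> shalika TYPE('a) n"
    using one_closed by (simp add: shalika_iff)
  show ?thesis
  proof (rule subgroupI)
    show "shalika TYPE('a) n \<subseteq> carrier (GL TYPE('a) (2 * n))"
      by (auto simp: shalika_iff)
    show "shalika TYPE('a) n \<noteq> {}" using one by blast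
  next
    fix M assume M: "M \<in> shalika TYPE('a) n"
    then obtain g x where g: "g \<in> carrier (GL TYPE('a) n)"
      and x: "x \<in> carrier_mat n n" and Me: "M = four_block_mat g x (0\<^sub>m n n) g"
      by (auto simp: shalika_def)
    obtain h where h: "h \<in> carrier (GL TYPE('a) n)" "g * h = 1\<^sub>m n" by (rule GL_inv[OF g])
    let ?N = "four_block_mat h (- (h * x * h)) (0\<^sub>m n n) h"
    note car = GL_carrierD[OF g] GL_carrierD[OF h(1)] x
    have N: "?N \<in> shalika TYPE('a) n"
      unfolding shalika_def using h(1) car by (auto intro!: exI)
    have "M * ?N = 1\<^sub>m (2 * n)"
      unfolding Me mult_2 by (rule block_upper_inverse) (use car h in auto)
    then have "?N * M = 1\<^sub>m (2 * n)"
      using mat_mult_left_right_inverse[of M "2 * n" ?N] M N GL_carrierD unfolding shalika_iff by blast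
    then have "inv\<^bsub>GL TYPE('a) (2 * n)\<^esub> M = ?N"
      using M N by (intro inv_equality) (auto simp: shalika_iff)
    then show "inv\<^bsub>GL TYPE('a) (2 * n)\<^esub> M \<in> shalika TYPE('a) n" using N by simp
  next
    fix M M' assume M: "M \<in> shalika TYPE('a) n" and M': "M' \<in> shalika TYPE('a) n"
    then obtain g x where g: "g \<in> carrier (GL TYPE('a) n)"
      and x: "x \<in> carrier_mat n n" and Me: "M = four_block_mat g x (0\<^sub>m n n) g"
      by (auto simp: shalika_def)
    obtain h y where h: "h \<in> carrier (GL TYPE('a) n)"
      and y: "y \<in> carrier_mat n n" and M'e: "M' = four_block_mat h y (0\<^sub>m n n) h"
      using M' by (auto simp: shalika_def)
    note car = GL_carrierD[OF g] GL_carrierD[OF h] x y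
    have "M * M' = four_block_mat (g * h) (g * y + x * h) (0\<^sub>m n n) (g * h)"
      unfolding Me M'e
      by (subst mult_four_block_mat[of _ n n _ n _ n _ _ n _ n]) (use car in simp_all)
    moreover have "g * h \<in> carrier (GL TYPE('a) n)"
      using group.subgroup_self[OF group_GL] subgroup.m_closed g h GL_mult by metis
    moreover have "g * y + x * h \<in> carrier_mat n n" using car by simp
    ultimately show "M \<otimes>\<^bsub>GL TYPE('a) (2 * n)\<^esub> M' \<in> shalika TYPE('a) n"
      unfolding shalika_def by auto
  qed
qed

text \<open>Row \<open>n + i\<close> of \<open>M\<close> is zero on the left half and repeats the
  left half of row \<open>i\<close> on the right. Taking the lower half of \<open>M f\<close> is
  therefore the same as applying \<open>M\<close> to the lower half of \<open>f\<close> moved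
  up.\<close>

lemma shift_app_shalika:
  assumes M: "M \<in> shalika TYPE('a::field) n"
  shows "shift n (app M f) = app M (shift n f)"
proof (rule ext)
  fix i
  have Mc: "M \<in> carrier_mat (2 * n) (2 * n)"
    using M GL_carrierD by (auto simp: shalika_iff)
  have z: "M $$ (i - 1, j - 1) = 0" if "n < i" "i \<le> 2 * n" "1 \<le> j" "j \<le> n" for i j
  proof -
    have "i - 1 - n < n" "j - 1 < n" using that by auto
    then have "M $$ (n + (i - 1 - n), j - 1) = 0"
      using M unfolding shalika_iff by blast
    then show ?thesis using that by simp
  qed
  \<comment> \<open>For \<open>i\<close> and \<open>j\<close> at least 1 the decrement can be moved
    past \<open>n\<close>, which matches one-based coordinates with zero-based blocks.\<close>
  have e: "M $$ (n + i - 1, n + j - 1) = M $$ (i - 1, j - 1)" if "1 \<le> i" "i \<le> n" "1 \<le> j" "j \<le> n" for i j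
  proof -
    have "i - 1 < n" "j - 1 < n" using that by auto
    then have "M $$ (n + (i - 1), n + (j - 1)) = M $$ (i - 1, j - 1)"
      using M unfolding shalika_iff by blast
    moreover have "n + i - 1 = n + (i - 1)" "n + j - 1 = n + (j - 1)" using that by auto
    ultimately show ?thesis by simp
  qed
  have split: "{1..2 * n} = {1..n} \<union> {n + 1..2 * n}" by auto
  have sum_split: "(\<Sum>j\<in>{1..2 * n}. h j) = (\<Sum>j\<in>{1..n}. h j) + (\<Sum>j\<in>{1..n}. h (n + j))" for h :: "nat \<Rightarrow> 'a"
  proof -
    have "(\<Sum>j\<in>{n + 1..2 * n}. h j) = (\<Sum>j\<in>{1..n}. h (n + j))"
      by (rule sum.reindex_bij_witness[of _ "\<lambda>j. n + j" "\<lambda>j. j - n"]) auto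
    then show ?thesis unfolding split by (subst sum.union_disjoint) auto
  qed
  consider "i \<in> {1..n}" | "i \<in> {n + 1..2 * n}" | "i \<notin> {1..2 * n}" by fastforce
  then show "shift n (app M f) i = app M (shift n f) i"
  proof cases
    case 1
    have "shift n (app M f) i = (\<Sum>j\<in>{1..2 * n}. M $$ (n + i - 1, j - 1) * f j)"
      using 1 Mc by (simp add: shift_def app_def)
    also have "\<dots> = (\<Sum>j\<in>{1..n}. M $$ (i - 1, j - 1) * f (n + j))"
      unfolding sum_split using 1 z[of "n + i"] e[of i] by simp
    also have "\<dots> = app M (shift n f) i"
      using 1 Mc unfolding app_def by (simp only: sum_split carrier_matD) (simp add: shift_def sum_split)
    finally show ?thesis .
  next
    case 2
    have "app M (shift n f) i = (\<Sum>j\<in>{1..2 * n}. M $$ (i - 1, j - 1) * shift n f j)"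
      using 2 Mc by (simp add: app_def)
    also have "\<dots> = 0" unfolding sum_split using 2 z[of i] by (simp add: shift_def)
    finally show ?thesis using 2 by (simp add: shift_def)
  next
    case 3
    then show ?thesis using Mc by (auto simp: shift_def app_def)
  qed
qed


section \<open>Subspaces up to the Shalika subgroup\<close>

text \<open>This computes the kernel of the nilpotent map. It shows later that two vectors with the
  same shift differ by an element of \<open>fun_space n\<close>.\<close>

lemma mem_fun_space_iff_shift:
  assumes "f \<in> fun_space (2 * n)"
  shows "f \<in> fun_space n \<longleftrightarrow> shift n f = 0"
proof
  assume "shift n f = 0"
  have z: "f (n + i) = 0" if "i \<in> {1..n}" for i
  proof -
    have "f (n + i) = shift n f i" using that by (simp add: shift_def)
    then show ?thesis using \<open>shift n f = 0\<close> by simp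
  qed
  have "f i = 0" if "i \<notin> {1..n}" for i
  proof (cases "i \<in> {n + 1..2 * n}")
    case True
    then have "f (n + (i - n)) = 0" by (intro z) auto
    then show ?thesis using True by auto
  next
    case False
    then show ?thesis using assms that by (auto simp: fun_space_def)
  qed
  then show "f \<in> fun_space n" by (simp add: fun_space_def)
qed (auto simp: fun_space_def shift_def fun_eq_iff)

section \<open>Bases adapted to two subspaces\<close>

lemma (in vector_space) independent_Un_span_Int:
  assumes S: "independent S" and T: "independent T" and ST: "span S \<inter> span T \<subseteq> {0}"
  shows "independent (S \<union> T)"
proof -
  \<comment> \<open>The asymmetric half, used twice with the roles of \<open>S\<close> and
    \<open>T\<close> exchanged. In \<open>a = x + y\<close> the part \<open>y = a - x\<close> lies
    in both spans, hence vanishes, and \<open>a = x\<close> contradicts independence of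
    \<open>S\<close>.\<close>
  have *: False if S: "independent S" and ST: "span S \<inter> span T \<subseteq> {0}" and a: "a \<in> S"
    and aS: "a \<in> span (S \<union> T - {a})" for a S T
  proof -
    have "a \<in> span ((S - {a}) \<union> T)"
      using aS span_mono[of "S \<union> T - {a}" "(S - {a}) \<union> T"] by blast
    then obtain x y where x: "x \<in> span (S - {a})" and y: "y \<in> span T" and axy: "a = x + y"
      unfolding span_Un by blast
    have "x \<in> span S" using x span_mono[of "S - {a}" S] by blast
    then have "y \<in> span S" using axy span_diff[OF span_base[OF a]] by (metis add_diff_cancel_left')
    then have "y = 0" using y ST by blast
    then show False using axy x S a by (auto simp: dependent_def)
  qed
  show ?thesis
    unfolding dependent_def using *[OF S ST] *[OF T] ST by (metis Int_commute Un_commute Un_iff)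
qed

text \<open>The coordinates of \<open>x\<close> with respect to \<open>B\<close> are supported both
  in \<open>S\<close> and in \<open>T\<close>, so all of them vanish.\<close>

lemma (in vector_space) independent_span_Int:
  assumes B: "independent B" and S: "S \<subseteq> B" and T: "T \<subseteq> B" and ST: "S \<inter> T = {}"
    and x: "x \<in> span S" "x \<in> span T"
  shows "x = 0"
proof -
  have "representation B x b = 0" for b
    using representation_extend[OF B x(1) S] representation_extend[OF B x(2) T]
      representation_ne_zero[of S x b] representation_ne_zero[of T x b] ST by force
  then show "x = 0"
    using sum_nonzero_representation_eq[OF B, of x] x(1) span_mono[OF S] by auto
qed

text \<open>A basis \<open>C\<close> of the intersection is extended to bases \<open>B1\<close> and
  \<open>B2\<close> of the two subspaces. A vector in the spans of \<open>B1\<close> and of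
  \<open>B2 - C\<close> lies in the intersection, hence in the span of \<open>C\<close>, and is zero
  by independence of \<open>B2\<close>. So \<open>B1 \<union> B2\<close> is independent and extends
  to a basis of \<open>W\<close>.\<close>

lemma (in vector_space) ex_adapted_basis:
  assumes U1: "subspace U1" and U2: "subspace U2" and W: "subspace W" and sub: "U1 \<subseteq> W" "U2 \<subseteq> W"
  obtains B B1 B2 where "independent B" "span B = W" "B1 \<subseteq> B" "B2 \<subseteq> B" "span B1 = U1" "span B2 = U2"
proof -
  obtain C where C: "C \<subseteq> U1 \<inter> U2" "independent C" "U1 \<inter> U2 \<subseteq> span C"
    using maximal_independent_subset[of "U1 \<inter> U2"] by blast
  obtain B1 where B1: "C \<subseteq> B1" "B1 \<subseteq> U1" "independent B1" "U1 \<subseteq> span B1"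
    using maximal_independent_subset_extend[of C U1] C by blast
  obtain B2 where B2: "C \<subseteq> B2" "B2 \<subseteq> U2" "independent B2" "U2 \<subseteq> span B2"
    using maximal_independent_subset_extend[of C U2] C by blast
  have span1: "span B1 = U1" and span2: "span B2 = U2"
    using span_subspace B1 B2 U1 U2 by blast+
  have indep: "independent (B1 \<union> (B2 - C))"
  proof (rule independent_Un_span_Int)
    show "independent (B2 - C)" using B2(3) independent_mono by blast
    show "span B1 \<inter> span (B2 - C) \<subseteq> {0}"
    proof
      fix x assume x: "x \<in> span B1 \<inter> span (B2 - C)"
      then have "x \<in> U1 \<inter> U2" using span1 span2 span_mono[of "B2 - C" B2] by blast
      then have xC: "x \<in> span C" using C by blast
      show "x \<in> {0}"
        using independent_span_Int[OF B2(3), of C "B2 - C" x] xC x B2(1) by blast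
    qed
  qed (fact B1(3))
  have "B1 \<union> (B2 - C) = B1 \<union> B2" using B1 by blast
  then obtain B where B: "B1 \<union> B2 \<subseteq> B" "B \<subseteq> W" "independent B" "W \<subseteq> span B"
    using maximal_independent_subset_extend[of "B1 \<union> B2" W] indep B1(2) B2(2) sub by (metis Un_least order_trans)
  show thesis
    using that[of B B1 B2] B span1 span2 span_subspace[OF B(2,4) W] by blast
qed

text \<open>The adapted basis is taken for \<open>U \<inter> ker N\<close> and \<open>N U\<close>
  inside \<open>ker N\<close>, where \<open>N\<close> is \<open>shift n\<close>; \<open>A1\<close>
  and \<open>A2\<close> index the basis vectors spanning these two subspaces.\<close>

lemma adapted_basis_fun_space:
  fixes U :: "(nat \<Rightarrow> 'a::field) set"
  assumes U: "fun_vs.subspace U" and sub: "U \<subseteq> fun_space (2 * n)"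
  obtains b c :: "nat \<Rightarrow> nat \<Rightarrow> 'a" and A1 A2 where
    "fun_vs.span (b ` {1..n}) = fun_space n" "A1 \<subseteq> {1..n}" "A2 \<subseteq> {1..n}"
    "\<forall>j\<in>{1..n}. c j \<in> fun_space (2 * n) \<and> shift n (c j) = b j"
    "b ` A1 \<subseteq> U" "c ` A2 \<subseteq> U" "U \<subseteq> fun_vs.span (b ` A1 \<union> c ` A2)"
proof -
  have "fun_vs.subspace (U \<inter> fun_space n)" "fun_vs.subspace (shift n ` U)"
    using U fun_space_subspace fun_vs.subspace_inter shift.subspace_image by blast+
  moreover have "shift n ` U \<subseteq> fun_space n" by (auto simp: shift_def fun_space_def)
  ultimately obtain B B1 B2 where B: "fun_vs.independent B" "fun_vs.span B = fun_space n"
    and B12: "B1 \<subseteq> B" "B2 \<subseteq> B" and span1: "fun_vs.span B1 = U \<inter> fun_space n"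
    and span2: "fun_vs.span B2 = shift n ` U"
    using fun_vs.ex_adapted_basis[of "U \<inter> fun_space n" "shift n ` U" "fun_space n"] fun_space_subspace
    by (metis inf_le2)
  have "B \<subseteq> fun_vs.span (unit_fun ` {1..n})"
    using B(2) fun_vs.span_superset span_unit_fun by blast
  \<comment> \<open>Exchange bounds against the unit vectors in both directions give
    \<open>card B = n\<close>, so \<open>B\<close> can be indexed by \<open>{1..n}\<close>.\<close>
  then have finB: "finite B" and "card B \<le> card ((unit_fun :: nat \<Rightarrow> nat \<Rightarrow> 'a) ` {1..n})"
    using fun_vs.independent_span_bound[OF _ B(1)] by auto
  moreover have "card ((unit_fun :: nat \<Rightarrow> nat \<Rightarrow> 'a) ` {1..n}) \<le> card B"
    using fun_vs.independent_span_bound[OF finB independent_unit_fun] B(2)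
      fun_vs.span_superset[of "unit_fun ` {1..n}"] unfolding span_unit_fun by blast
  ultimately have "card B = n"
    using card_unit_fun_image[of "{1..n}", where ?'a = 'a] by simp
  then obtain b where b: "bij_betw b {1..n} B"
    using finite_same_card_bij[of "{1..n}" B] finB by auto
  then have bB: "b ` {1..n} = B" by (simp add: bij_betw_def)
  have ex_c: "\<exists>f \<in> fun_space (2 * n). shift n f = b j \<and> (b j \<in> B2 \<longrightarrow> f \<in> U)" if "j \<in> {1..n}" for j
  proof (cases "b j \<in> B2")
    case True
    then have "b j \<in> shift n ` U" using span2 fun_vs.span_base by blast
    then show ?thesis using sub by auto
  next
    case False
    \<comment> \<open>Outside \<open>N U\<close> any preimage will do; this one is the copy of
      \<open>b j\<close> in the lower half.\<close>
    define f where "f i = (if n < i then b j (i - n) else 0)" for i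
    have "b j \<in> fun_space n" using bB that B(2) fun_vs.span_base by blast
    then have b0: "b j i = 0" if "i \<notin> {1..n}" for i using that by (simp add: fun_space_def)
    then have "f \<in> fun_space (2 * n)" "shift n f = b j"
      by (auto simp: f_def fun_space_def shift_def fun_eq_iff intro!: b0)
    then show ?thesis using False by blast
  qed
  then obtain c where c: "c j \<in> fun_space (2 * n)" "shift n (c j) = b j" "b j \<in> B2 \<Longrightarrow> c j \<in> U"
    if "j \<in> {1..n}" for j by metis
  define A1 A2 where "A1 = {j \<in> {1..n}. b j \<in> B1}" and "A2 = {j \<in> {1..n}. b j \<in> B2}"
  have bA1: "b ` A1 = B1" and bA2: "b ` A2 = B2"
    using bB B12 unfolding A1_def A2_def by blast+
  have spanU: "U \<subseteq> fun_vs.span (b ` A1 \<union> c ` A2)"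
  proof
    fix u assume u: "u \<in> U"
    have "shift n ` c ` A2 = B2"
      unfolding bA2[symmetric] image_image by (rule image_cong) (auto simp: A2_def c)
    then have "fun_vs.span B2 = shift n ` fun_vs.span (c ` A2)"
      by (metis shift.span_image)
    \<comment> \<open>The span of \<open>c\<close> A2\<open>already maps onto\<close>N
      U\<open>, so\<close>u\<open>can be corrected by some\<close>v\<open>in it with the same shift. The difference lies in\<close>U
      \<inter> ker N\<open>, the span of\<close>b \<open>A1\<close>.\<close>
    then obtain v where v: "v \<in> fun_vs.span (c ` A2)" "shift n u = shift n v"
      using u span2 by blast
    have "fun_vs.span (c ` A2) \<subseteq> U"
      by (rule fun_vs.span_minimal[OF _ U]) (auto simp: A2_def c)
    then have uv: "u - v \<in> U" using fun_vs.subspace_diff[OF U u] v(1) by blast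
    moreover have "u - v \<in> fun_space n"
      using mem_fun_space_iff_shift[of "u - v" n] uv sub v(2) by (auto simp: shift.diff)
    ultimately have "u - v \<in> fun_vs.span (b ` A1)" using span1 bA1 by blast
    then have "v + (u - v) \<in> fun_vs.span (b ` A1 \<union> c ` A2)"
      using v(1) fun_vs.span_mono[of "b ` A1" "b ` A1 \<union> c ` A2"] fun_vs.span_mono[of "c ` A2" "b ` A1 \<union> c ` A2"]
      by (intro fun_vs.span_add) auto
    then show "u \<in> fun_vs.span (b ` A1 \<union> c ` A2)" by simp
  qed
  have bU: "b ` A1 \<subseteq> U" unfolding bA1 using span1 fun_vs.span_superset by blast
  have cU: "c ` A2 \<subseteq> U" using c by (auto simp: A2_def)
  have A12: "A1 \<subseteq> {1..n}" "A2 \<subseteq> {1..n}" by (auto simp: A1_def A2_def)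
  have spanb: "fun_vs.span (b ` {1..n}) = fun_space n" by (simp only: bB B(2))
  have "\<forall>j\<in>{1..n}. c j \<in> fun_space (2 * n) \<and> shift n (c j) = b j" using c(1,2) by blast
  from that[OF spanb A12 this bU cU spanU] show thesis .
qed

lemma GL_mult_closed:
  "M \<in> carrier (GL TYPE('a::field) m) \<Longrightarrow> N \<in> carrier (GL TYPE('a) m) \<Longrightarrow> M * N \<in> carrier (GL TYPE('a) m)"
  using monoid.m_closed[OF group.is_monoid[OF group_GL]] by simp

lemma perm_mat_GL: "\<sigma> permutes {1..m} \<Longrightarrow> perm_mat TYPE('a::field) m \<sigma> \<in> carrier (GL TYPE('a) m)"
  using subgroup.mem_carrier[OF subgroup_Sym] by (auto simp: Sym_def)

text \<open>The matrix \<open>s\<close> has columns \<open>b 1, ..., b n, c 1, ..., c n\<close>. The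
  relation \<open>shift n (c j) = b j\<close> says that the lower half of \<open>c j\<close> is
  \<open>b j\<close>, which is exactly the equality of the diagonal blocks.\<close>

lemma ex_shalika_basis:
  fixes U :: "(nat \<Rightarrow> 'a::field) set"
  assumes U: "fun_vs.subspace U" and sub: "U \<subseteq> fun_space (2 * n)"
  obtains s A where "s \<in> shalika TYPE('a) n" "A \<subseteq> {1..2 * n}"
    "app s ` unit_fun ` A \<subseteq> U" "U \<subseteq> fun_vs.span (app s ` unit_fun ` A)"
proof -
  obtain b c :: "nat \<Rightarrow> nat \<Rightarrow> 'a" and A1 A2 where
    b: "fun_vs.span (b ` {1..n}) = fun_space n" and A12: "A1 \<subseteq> {1..n}" "A2 \<subseteq> {1..n}" and
    cc: "\<forall>j\<in>{1..n}. c j \<in> fun_space (2 * n) \<and> shift n (c j) = b j" and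
    inU: "b ` A1 \<subseteq> U" "c ` A2 \<subseteq> U" and
    spanU: "U \<subseteq> fun_vs.span (b ` A1 \<union> c ` A2)"
    using adapted_basis_fun_space[OF U sub] .
  have c: "c j \<in> fun_space (2 * n)" "shift n (c j) = b j" if "j \<in> {1..n}" for j
    using cc that by blast+
  define g where "g = mat n n (\<lambda>(i, j). b (Suc j) (Suc i))"
  define x where "x = mat n n (\<lambda>(i, j). c (Suc j) (Suc i))"
  define s where "s = four_block_mat g x (0\<^sub>m n n) g"
  have gx: "g \<in> carrier_mat n n" "x \<in> carrier_mat n n" by (simp_all add: g_def x_def)
  have bn: "b j \<in> fun_space n" if "j \<in> {1..n}" for j
    using b that fun_vs.span_base by blast
  have "app g (unit_fun j) = b j" if "j \<in> {1..n}" for j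
    using bn[OF that] that by (subst app_unit_fun) (auto simp: g_def fun_space_def fun_eq_iff)
  then have "app g ` unit_fun ` {1..n} = b ` {1..n}"
    unfolding image_image by (intro image_cong) auto
  then have "g \<in> carrier (GL TYPE('a) n)"
    by (intro GL_if_span gx(1)) (simp only: b order_refl)
  then have s: "s \<in> shalika TYPE('a) n" using gx by (auto simp: shalika_def s_def)
  have sc: "s \<in> carrier_mat (2 * n) (2 * n)" using gx by (simp add: s_def mult_2)
  have sb: "app s (unit_fun j) = b j" if "j \<in> {1..n}" for j
    using bn[OF that] that sc
    by (subst app_unit_fun) (auto simp: s_def g_def x_def fun_space_def fun_eq_iff)
  have sc': "app s (unit_fun (n + j)) = c j" if "j \<in> {1..n}" for j
  proof (rule ext)
    fix i
    have cb: "c j (n + i') = b j i'" if "i' \<in> {1..n}" for i'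
      using fun_cong[OF c(2)[OF \<open>j \<in> {1..n}\<close>], of i'] that by (simp add: shift_def)
    show "app s (unit_fun (n + j)) i = c j i"
    proof (cases "i \<le> n")
      case True
      then show ?thesis
        using c(1)[OF that] that sc
        by (subst app_unit_fun) (auto simp: s_def g_def x_def fun_space_def)
    next
      case False
      then obtain i' where i': "i = n + Suc i'"
        using less_iff_Suc_add[of n i] by auto
      obtain j' where j': "j = Suc j'" using \<open>j \<in> {1..n}\<close> by (cases j) auto
      show ?thesis
      proof (cases "i' < n")
        case True
        have "app s (unit_fun (n + j)) i = s $$ (n + i', n + j')"
          using that sc i' j' True by (subst app_unit_fun) auto
        also have "\<dots> = b j (Suc i')"
          using that gx i' j' True by (simp add: s_def) (simp add: g_def)
        finally show ?thesis using cb[of "Suc i'"] i' True by simp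
      next
        case False
        then show ?thesis
          using c(1)[OF that] that sc i' by (subst app_unit_fun) (auto simp: fun_space_def)
      qed
    qed
  qed
  have im: "app s ` unit_fun ` (A1 \<union> (+) n ` A2) = b ` A1 \<union> c ` A2"
  proof -
    have "app s ` unit_fun ` A1 = b ` A1"
      unfolding image_image using A12 sb by (intro image_cong) auto
    moreover have "app s ` unit_fun ` (+) n ` A2 = c ` A2"
      unfolding image_image using A12 sc' by (intro image_cong) auto
    ultimately show ?thesis by (simp only: image_Un)
  qed
  show thesis
  proof (rule that[OF s])
    show "A1 \<union> (+) n ` A2 \<subseteq> {1..2 * n}" using A12 by fastforce
  qed (use inU spanU in \<open>auto simp only: im\<close>)
qed

section \<open>Permutation matrices in every double coset\<close>

lemma card_unit_fun_image_le:
  fixes f :: "(nat \<Rightarrow> 'a::field) \<Rightarrow> nat \<Rightarrow> 'a"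
  assumes "finite A" and "unit_fun ` B \<subseteq> fun_vs.span (f ` (unit_fun ` A :: (nat \<Rightarrow> 'a) set))"
  shows "card B \<le> card A"
proof -
  have "card B = card (unit_fun ` B :: (nat \<Rightarrow> 'a) set)"
    by (rule card_unit_fun_image[symmetric])
  also have "\<dots> \<le> card (f ` (unit_fun ` A :: (nat \<Rightarrow> 'a) set))"
    using fun_vs.independent_span_bound[OF _ independent_unit_fun assms(2)] assms(1) by simp
  also have "\<dots> \<le> card A"
    using card_image_le assms(1) by (metis image_image)
  finally show ?thesis .
qed

text \<open>The coset of \<open>g\<close> modulo the parabolic subgroup is recorded by
  \<open>U = g F^r\<close>. If \<open>s w\<close> maps \<open>F^r\<close> into \<open>U\<close>,
  with \<open>w\<close> the matrix of \<open>\<sigma>\<close>, then \<open>g^-1 s w\<close>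
  preserves \<open>F^r\<close> and is parabolic.\<close>

lemma GL_eq_shalika_perm_parabolic:
  fixes g :: "'a::field mat"
  assumes g: "g \<in> carrier (GL TYPE('a) (2 * n))" and r: "r \<le> 2 * n"
  obtains s \<sigma> p where "s \<in> shalika TYPE('a) n" "\<sigma> permutes {1..2 * n}"
    "p \<in> parabolic TYPE('a) r (2 * n - r)" "g = s * perm_mat TYPE('a) (2 * n) \<sigma> * p"
proof -
  note gc = GL_carrierD[OF g]
  have pq: "r + (2 * n - r) = 2 * n" using r by simp
  define U where "U = app g ` fun_space r"
  have U: "fun_vs.subspace U"
    unfolding U_def by (rule app.subspace_image[OF fun_space_subspace])
  have subU: "U \<subseteq> fun_space (2 * n)"
    unfolding U_def using app_in_fun_space[of g] gc by auto
  obtain s A where s: "s \<in> shalika TYPE('a) n" and A: "A \<subseteq> {1..2 * n}"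
    and sA: "app s ` unit_fun ` A \<subseteq> U" and span: "U \<subseteq> fun_vs.span (app s ` unit_fun ` A)"
    using ex_shalika_basis[OF U subU] .
  obtain h where h: "h \<in> carrier (GL TYPE('a) (2 * n))" "g * h = 1\<^sub>m (2 * n)" "h * g = 1\<^sub>m (2 * n)"
    by (rule GL_inv[OF g])
  note hc = GL_carrierD[OF h(1)]
  have hg: "app h (app g f) = f" if "f \<in> fun_space (2 * n)" for f
    using app_mult[OF hc gc, of f] h(3) app_one[OF that] by simp
  have r_sub: "fun_space r \<subseteq> (fun_space (2 * n) :: (nat \<Rightarrow> 'a) set)"
    using r by (auto simp: fun_space_def)
  have hU: "app h ` U = fun_space r"
  proof -
    have "app h ` U = (\<lambda>f. f) ` fun_space r"
      unfolding U_def image_image using hg r_sub by (intro image_cong) auto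
    then show ?thesis by simp
  qed
  have "unit_fun ` {1..r} \<subseteq> (fun_space r :: (nat \<Rightarrow> 'a) set)"
    using unit_fun_in_fun_space by blast
  also have "\<dots> \<subseteq> app h ` fun_vs.span (app s ` unit_fun ` A)"
    using hU span by blast
  also have "\<dots> = fun_vs.span ((app h \<circ> app s) ` unit_fun ` A)"
    unfolding image_comp[symmetric] app.span_image ..
  \<comment> \<open>An \<open>r\<close>-subset \<open>A'\<close> of \<open>A\<close> is enough,
    because the rest of the argument uses only that \<open>s\<close> maps its unit vectors into
    \<open>U\<close>.\<close>
  finally have "card {1..r} \<le> card A"
    using finite_subset[OF A] by (intro card_unit_fun_image_le) auto
  then obtain A' where A': "A' \<subseteq> A" "card A' = r"
    using obtain_subset_with_card_n[of r A] by auto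
  obtain \<sigma> where sg: "\<sigma> permutes {1..2 * n}" "\<sigma> ` {1..r} = A'"
    \<comment> \<open>With the second set of each pair empty, the classification of pairs extends a
      matching of single sets.\<close>
    by (rule ex_permutes_image2[of "{1..2 * n}" "{1..r}" "{}" A' "{}"]) (use A A' r in auto)
  let ?w = "perm_mat TYPE('a) (2 * n) \<sigma>"
  have sG: "s \<in> carrier (GL TYPE('a) (2 * n))" using s by (simp add: shalika_iff)
  note sc = GL_carrierD[OF sG]
  have wG: "?w \<in> carrier (GL TYPE('a) (2 * n))" by (rule perm_mat_GL[OF sg(1)])
  define q where "q = h * (s * ?w)"
  have qG: "q \<in> carrier (GL TYPE('a) (2 * n))"
    unfolding q_def by (intro GL_mult_closed h(1) sG wG)
  have app_q: "app q (unit_fun j) \<in> fun_space r" if "j \<in> {1..r}" for j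
  proof -
    have j: "j \<in> {1..2 * n}" using that r by auto
    have "app q (unit_fun j) = app h (app s (unit_fun (\<sigma> j)))"
      unfolding q_def using app_mult[OF hc mult_carrier_mat[OF sc perm_mat_carrier]]
        app_mult[OF sc perm_mat_carrier] app_perm_mat[OF sg(1) j] by metis
    also have "\<dots> \<in> app h ` U" using sg(2) A' sA that by blast
    finally show ?thesis using hU by simp
  qed
  have "q $$ (r + i, j) = 0" if "i < 2 * n - r" "j < r" for i j
  proof -
    have "Suc (r + i) \<le> 2 * n" using that by simp
    have "app q (unit_fun (Suc j)) (Suc (r + i)) = 0"
      using app_q[of "Suc j"] that by (auto simp: fun_space_def)
    then show ?thesis
      using GL_carrierD[OF qG] that r \<open>Suc (r + i) \<le> 2 * n\<close> by (subst (asm) app_unit_fun) auto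
  qed
  then have q: "q \<in> parabolic TYPE('a) r (2 * n - r)"
    using qG by (simp add: parabolic_iff pq)
  have inv_q: "inv\<^bsub>GL TYPE('a) (2 * n)\<^esub> q \<in> parabolic TYPE('a) r (2 * n - r)"
    using subgroup.m_inv_closed[OF parabolic_subgroup q] by (simp add: pq)
  obtain q' where q': "inv\<^bsub>GL TYPE('a) (2 * n)\<^esub> q = q'" "q * q' = 1\<^sub>m (2 * n)"
    "q' \<in> carrier (GL TYPE('a) (2 * n))"
    using GL_inv[OF qG] by metis
  have "g * q = (g * h) * (s * ?w)"
    unfolding q_def using assoc_mult_mat[OF gc hc mult_carrier_mat[OF sc perm_mat_carrier]] by simp
  also have "\<dots> = s * ?w" using h(2) sc by simp
  finally have "s * ?w * q' = g * (q * q')"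
    using assoc_mult_mat[OF gc GL_carrierD[OF qG] GL_carrierD[OF q'(3)]] by simp
  also have "\<dots> = g" using q'(2) gc by simp
  finally show thesis
    using that[OF s sg(1), of q'] inv_q q'(1) by simp
qed

section \<open>Invariants of the double cosets\<close>

text \<open>
  For the subspace \<open>U\<close> spanned by \<open>e\<^sub>i\<close>, \<open>i \<in> \<sigma> {1..r}\<close>, the two cardinalities are the
  dimensions of \<open>shift U\<close> and \<open>U + shift U\<close>.
\<close>

lemma shalika_perm_invariants:
  assumes s: "s \<in> shalika TYPE('a::field) n" and p: "p \<in> parabolic TYPE('a) r (2 * n - r)"
    and sg: "\<sigma> permutes {1..2 * n}" and sg': "\<sigma>' permutes {1..2 * n}" and r: "r \<le> 2 * n"
    and eq: "perm_mat TYPE('a) (2 * n) \<sigma>' = s * perm_mat TYPE('a) (2 * n) \<sigma> * p"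
  shows "card (bot_set n r \<sigma>') \<le> card (bot_set n r \<sigma>)"
    and "card (\<sigma>' ` {1..r} \<union> bot_set n r \<sigma>') \<le> card (\<sigma> ` {1..r} \<union> bot_set n r \<sigma>)"
proof -
  let ?w = "perm_mat TYPE('a) (2 * n) \<sigma>" and ?X = "\<sigma> ` {1..r}" and ?X' = "\<sigma>' ` {1..r}"
  let ?B = "bot_set n r \<sigma>" and ?B' = "bot_set n r \<sigma>'"
  let ?u = "unit_fun :: nat \<Rightarrow> nat \<Rightarrow> 'a"
  have pq: "r + (2 * n - r) = 2 * n" using r by simp
  have pG: "p \<in> carrier (GL TYPE('a) (2 * n))"
    and pz: "\<And>i j. i < 2 * n - r \<Longrightarrow> j < r \<Longrightarrow> p $$ (r + i, j) = 0"
    using p by (simp_all add: parabolic_iff pq)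
  note pc = GL_carrierD[OF pG]
  have sc: "s \<in> carrier_mat (2 * n) (2 * n)" using s GL_carrierD by (auto simp: shalika_iff)
  have wX: "app ?w ` fun_space r = fun_vs.span (?u ` ?X)"
  proof -
    have "app ?w ` ?u ` {1..r} = ?u ` ?X"
      unfolding image_image using app_perm_mat[OF sg, where ?'a = 'a] r by (intro image_cong) auto
    then show ?thesis by (metis app.span_image span_unit_fun)
  qed
  \<comment> \<open>As \<open>p\<close> preserves \<open>F^r\<close>, the image of
    \<open>F^r\<close> under the matrix of \<open>\<sigma>'\<close> lies in \<open>s w F^r\<close>,
    with \<open>w\<close> the matrix of \<open>\<sigma>\<close>.\<close>
  have X': "?u ` ?X' \<subseteq> app s ` fun_vs.span (?u ` ?X)"
  proof (clarify)
    fix j assume j: "j \<in> {1..r}"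
    then have j': "j \<in> {1..2 * n}" using r by auto
    have "app p (?u j) \<in> fun_space r"
      unfolding fun_space_def
    proof (clarify)
      fix i assume i: "i \<notin> {1..r}"
      have "p $$ (i - 1, j - 1) = 0" if "i \<in> {1..2 * n}"
        using pz[of "i - 1 - r" "j - 1"] that i j by auto
      then show "app p (?u j) i = 0" using pc j' by (simp add: app_unit_fun)
    qed
    then have "app ?w (app p (?u j)) \<in> fun_vs.span (?u ` ?X)" using wX by blast
    moreover have "?u (\<sigma>' j) = app s (app ?w (app p (?u j)))"
      using app_perm_mat[OF sg' j', where ?'a = 'a] app_mult[OF mult_carrier_mat[OF sc perm_mat_carrier] pc]
        app_mult[OF sc perm_mat_carrier] eq by metis
    ultimately show "?u (\<sigma>' j) \<in> app s ` fun_vs.span (?u ` ?X)" by blast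
  qed
  have shiftX: "shift n ` ?u ` ?X \<subseteq> fun_vs.span (?u ` ?B)"
  proof (clarify)
    fix j assume j: "j \<in> {1..r}"
    show "shift n (?u (\<sigma> j)) \<in> fun_vs.span (?u ` ?B)"
    proof (cases "\<sigma> j \<in> {n + 1..2 * n}")
      case True
      then have "shift n (?u (\<sigma> j)) = ?u (\<sigma> j - n)"
        by (auto simp: shift_def unit_fun_def fun_eq_iff)
      moreover have "\<sigma> j - n \<in> ?B" using True j by (auto simp: bot_set_def)
      ultimately show ?thesis by (metis fun_vs.span_base imageI)
    next
      case False
      then have "shift n (?u (\<sigma> j)) = 0"
        by (auto simp: shift_def unit_fun_def fun_eq_iff)
      then show ?thesis by (simp add: fun_vs.span_zero)
    qed
  qed
  \<comment> \<open>An index \<open>j\<close> of \<open>?B'\<close> is lifted to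
    \<open>n + j\<close> in \<open>?X'\<close>; applying \<open>shift n\<close>, which commutes with
    \<open>s\<close>, carries the containment over from \<open>X'\<close>.\<close>
  have B': "?u ` ?B' \<subseteq> app s ` fun_vs.span (?u ` ?B)"
  proof (clarify)
    fix j assume j: "j \<in> ?B'"
    then have "n + j \<in> ?X'" and jn: "j \<in> {1..n}" by (auto simp: bot_set_def)
    then obtain f where f: "f \<in> fun_vs.span (?u ` ?X)" "?u (n + j) = app s f"
      using X' by blast
    have "?u j = shift n (?u (n + j))"
      using jn by (auto simp: shift_def unit_fun_def fun_eq_iff)
    also have "\<dots> = app s (shift n f)" using f(2) shift_app_shalika[OF s] by metis
    finally have "?u j = app s (shift n f)" .
    moreover have "shift n f \<in> fun_vs.span (shift n ` ?u ` ?X)"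
      using f(1) unfolding shift.span_image by blast
    then have "shift n f \<in> fun_vs.span (?u ` ?B)"
      using fun_vs.span_minimal[OF shiftX] fun_vs.subspace_span by blast
    ultimately show "?u j \<in> app s ` fun_vs.span (?u ` ?B)" by blast
  qed
  show "card ?B' \<le> card ?B"
    using B' by (intro card_unit_fun_image_le[of _ _ "app s"]) (auto simp: app.span_image)
  have "?u ` (?X' \<union> ?B') \<subseteq> fun_vs.span (app s ` ?u ` (?X \<union> ?B))"
    using X' B' fun_vs.span_mono[of "?u ` ?X" "?u ` (?X \<union> ?B)"] fun_vs.span_mono[of "?u ` ?B" "?u ` (?X \<union> ?B)"]
    unfolding app.span_image by blast
  then show "card (?X' \<union> ?B') \<le> card (?X \<union> ?B)"
    by (intro card_unit_fun_image_le[of _ _ "app s"]) auto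
qed


text \<open>The relation between the two permutations is symmetric, so the inequalities for the
  invariants hold both ways and become equalities.\<close>

lemma card_top_bot_eq:
  assumes s: "s \<in> shalika TYPE('a::field) n" and p: "p \<in> parabolic TYPE('a) r (2 * n - r)"
    and sg: "\<sigma> permutes {1..2 * n}" and sg': "\<sigma>' permutes {1..2 * n}" and r: "r \<le> 2 * n"
    and eq: "perm_mat TYPE('a) (2 * n) \<sigma>' = s * perm_mat TYPE('a) (2 * n) \<sigma> * p"
  shows "card (top_set n r \<sigma>) = card (top_set n r \<sigma>')"
    and "card (top_set n r \<sigma> \<inter> bot_set n r \<sigma>) = card (top_set n r \<sigma>' \<inter> bot_set n r \<sigma>')"
proof -
  have pq: "r + (2 * n - r) = 2 * n" using r by simp
  interpret group "GL TYPE('a) (2 * n)" by (rule group_GL)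
  interpret S: subgroup "shalika TYPE('a) n" "GL TYPE('a) (2 * n)" by (rule shalika_subgroup)
  interpret P: subgroup "parabolic TYPE('a) r (2 * n - r)" "GL TYPE('a) (2 * n)"
    using parabolic_subgroup[where ?'a = 'a, of r "2 * n - r"] by (simp only: pq)
  let ?w = "perm_mat TYPE('a) (2 * n) \<sigma>" and ?w' = "perm_mat TYPE('a) (2 * n) \<sigma>'"
  have "?w' \<in> double_coset (GL TYPE('a) (2 * n)) (shalika TYPE('a) n) ?w (parabolic TYPE('a) r (2 * n - r))"
    using s p eq by (auto simp: double_coset_iff)
  then have "?w \<in> double_coset (GL TYPE('a) (2 * n)) (shalika TYPE('a) n) ?w' (parabolic TYPE('a) r (2 * n - r))"
    using double_coset_eq[OF S.subgroup_axioms P.subgroup_axioms perm_mat_GL[OF sg]]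
      double_coset_self[OF S.subgroup_axioms P.subgroup_axioms perm_mat_GL[OF sg]] by blast
  then obtain s' p' where s': "s' \<in> shalika TYPE('a) n" and p': "p' \<in> parabolic TYPE('a) r (2 * n - r)"
    and eq': "?w = s' * ?w' * p'"
    by (auto simp: double_coset_iff)
  have b: "card (bot_set n r \<sigma>) = card (bot_set n r \<sigma>')"
    and u: "card (\<sigma> ` {1..r} \<union> bot_set n r \<sigma>) = card (\<sigma>' ` {1..r} \<union> bot_set n r \<sigma>')"
    using shalika_perm_invariants[OF s p sg sg' r eq] shalika_perm_invariants[OF s' p' sg' sg r eq']
    by simp_all
  then show top: "card (top_set n r \<sigma>) = card (top_set n r \<sigma>')"
    using card_top_bot[OF sg r] card_top_bot[OF sg' r] by simp
  \<comment> \<open>Inclusion and exclusion: the bottom set lies in \<open>{1..n}\<close>, so it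
    meets the image of \<open>{1..r}\<close> exactly in its overlap with the top set.\<close>
  have "card (\<rho> ` {1..r} \<union> bot_set n r \<rho>) + card (top_set n r \<rho> \<inter> bot_set n r \<rho>) = r + card (bot_set n r \<rho>)"
    if \<rho>: "\<rho> permutes {1..2 * n}" for \<rho>
  proof -
    have "\<rho> ` {1..r} \<inter> bot_set n r \<rho> = top_set n r \<rho> \<inter> bot_set n r \<rho>"
      by (auto simp: top_set_def bot_set_def)
    moreover have "card (\<rho> ` {1..r}) = r"
      using card_image[OF permutes_inj_on[OF \<rho>]] by simp
    ultimately show ?thesis
      using card_Un_Int[of "\<rho> ` {1..r}" "bot_set n r \<rho>"] by simp
  qed
  from this[OF sg] this[OF sg'] b u
  show "card (top_set n r \<sigma> \<inter> bot_set n r \<sigma>) = card (top_set n r \<sigma>' \<inter> bot_set n r \<sigma>')"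
    by simp
qed

text \<open>With the analogous inclusion for \<open>Sym_prod\<close>, this places each double coset
  of the symmetric group inside one of the general linear group.\<close>

lemma Delta_Sym_subset_shalika: "Delta_Sym TYPE('a::field) n \<subseteq> shalika TYPE('a) n"
proof
  fix M assume "M \<in> Delta_Sym TYPE('a) n"
  then obtain \<sigma> where s: "\<sigma> \<in> diagonal_perms n" and M: "M = perm_mat TYPE('a) (2 * n) \<sigma>"
    by (auto simp: Delta_Sym_eq)
  have "\<sigma> (Suc j) \<le> n" "\<sigma> (Suc (n + j)) = n + \<sigma> (Suc j)" if "j < n" for j
    using s that unfolding diagonal_perms_def by (auto dest!: bspec[of _ _ "Suc j"])
  then show "M \<in> shalika TYPE('a) n"
    using perm_mat_GL[OF diagonal_perms_permutes[OF s], where ?'a = 'a] by (fastforce simp: shalika_iff M)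
qed

lemma Sym_prod_subset_parabolic: "Sym_prod TYPE('a::field) p q \<subseteq> parabolic TYPE('a) p q"
proof
  fix M assume "M \<in> Sym_prod TYPE('a) p q"
  then obtain \<sigma> where s: "\<sigma> permutes {1..p + q}" "\<sigma> ` {1..p} = {1..p}"
    and M: "M = perm_mat TYPE('a) (p + q) \<sigma>"
    by (auto simp: Sym_prod_eq block_perms_def)
  have "\<sigma> (Suc j) \<le> p" if "j < p" for j
    using s(2) that imageI[of "Suc j" "{1..p}" \<sigma>] by auto
  then show "M \<in> parabolic TYPE('a) p q"
    using perm_mat_GL[OF s(1), where ?'a = 'a] by (fastforce simp: parabolic_iff M)
qed

section \<open>The classification\<close>

theorem theorem1p3:
  fixes n r :: nat
  assumes "1 \<le> r" and "r < 2 * n"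
  shows "(\<forall>k l. admissible n r k l \<longrightarrow>
            w_mat TYPE('a::field) n r k l \<in> carrier (Sym_group TYPE('a) (2 * n)))
       \<and> complete_double_coset_reps (Sym_group TYPE('a) (2 * n))
            (Delta_Sym TYPE('a) n) (Sym_prod TYPE('a) r (2 * n - r))
            {w_mat TYPE('a) n r k l | k l. admissible n r k l}
       \<and> (\<exists>f. bij_betw f
            (double_cosets (GL TYPE('a) (2 * n))
               (shalika TYPE('a) n) (parabolic TYPE('a) r (2 * n - r)))
            (double_cosets (Sym_group TYPE('a) (2 * n))
               (Delta_Sym TYPE('a) n) (Sym_prod TYPE('a) r (2 * n - r))))"
proof -
  let ?GL = "GL TYPE('a) (2 * n)" and ?Sym = "Sym_group TYPE('a) (2 * n)"
  let ?S = "shalika TYPE('a) n" and ?P = "parabolic TYPE('a) r (2 * n - r)"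
  let ?D = "Delta_Sym TYPE('a) n" and ?B = "Sym_prod TYPE('a) r (2 * n - r)"
  let ?C = "{w_mat TYPE('a) n r k l | k l. admissible n r k l}"
  have r: "r \<le> 2 * n" and pq: "r + (2 * n - r) = 2 * n" using assms by simp_all
  note w_eq = w_mat_eq_perm_mat[OF assms(2), where ?'a = 'a]
  note w_perm = w_perm_permutes[OF assms(2)]
  have P: "subgroup ?P ?GL" and B: "subgroup ?B ?Sym"
    using parabolic_subgroup[where ?'a = 'a, of r "2 * n - r"]
      subgroup_Sym_prod[where ?'a = 'a, of r "2 * n - r"] by (simp_all only: pq)
  have wSym: "w_mat TYPE('a) n r k l \<in> carrier ?Sym" if "admissible n r k l" for k l
    using w_perm[OF that] by (auto simp: Sym_def w_eq[OF that])
  \<comment> \<open>The values \<open>k\<close> and \<open>l\<close> are read off from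
    \<open>\<sigma>\<close>; equal cardinalities then put \<open>\<sigma>\<close> into the double
    coset of \<open>w_perm n r k l\<close>.\<close>
  have cover: "\<exists>g\<in>?C. perm_mat TYPE('a) (2 * n) \<sigma> \<in> double_coset ?Sym ?D g ?B"
    if \<sigma>: "\<sigma> permutes {1..2 * n}" for \<sigma>
  proof -
    define k l where "k = card (top_set n r \<sigma>)" and "l = card (top_set n r \<sigma> \<inter> bot_set n r \<sigma>)"
    have adm: "admissible n r k l" unfolding k_def l_def by (rule admissible_top_bot[OF \<sigma> r])
    have "card (top_set n r (w_perm n r k l)) = card (top_set n r \<sigma>)"
      "card (top_set n r (w_perm n r k l) \<inter> bot_set n r (w_perm n r k l))
         = card (top_set n r \<sigma> \<inter> bot_set n r \<sigma>)"
      by (simp_all only: card_top_set_w_perm[OF assms(2) adm] card_top_bot_w_perm[OF assms(2) adm]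
          flip: k_def l_def)
    then obtain \<delta> \<tau> where d: "\<delta> \<in> diagonal_perms n" and t: "\<tau> \<in> block_perms r (2 * n)"
      and eq: "\<sigma> = \<delta> \<circ> w_perm n r k l \<circ> \<tau>"
      using ex_diagonal_block_perms[OF w_perm[OF adm] \<sigma> r] by blast
    have tp: "\<tau> permutes {1..2 * n}" using t by (simp add: block_perms_def)
    have "perm_mat TYPE('a) (2 * n) \<sigma> = perm_mat TYPE('a) (2 * n) \<delta> * w_mat TYPE('a) n r k l * perm_mat TYPE('a) (2 * n) \<tau>"
      unfolding eq w_eq[OF adm] using diagonal_perms_permutes[OF d] w_perm[OF adm] tp
      by (simp add: perm_mat_comp permutes_compose del: o_apply)
    then have "perm_mat TYPE('a) (2 * n) \<sigma> \<in> double_coset ?Sym ?D (w_mat TYPE('a) n r k l) ?B"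
      using d t by (auto simp: double_coset_iff Delta_Sym_eq Sym_prod_eq pq)
    then show ?thesis using adm by blast
  qed
  \<comment> \<open>Uniqueness is proved for the larger double cosets of the general linear group;
    by \<open>dc_sub\<close> it also settles the symmetric group.\<close>
  have uniq: "g = g'" if "g \<in> ?C" "g' \<in> ?C" and dc: "g' \<in> double_coset ?GL ?S g ?P" for g g'
  proof -
    obtain k l k' l' where a: "admissible n r k l" "g = w_mat TYPE('a) n r k l"
      and a': "admissible n r k' l'" "g' = w_mat TYPE('a) n r k' l'"
      using \<open>g \<in> ?C\<close> \<open>g' \<in> ?C\<close> by blast
    obtain s p where s: "s \<in> ?S" and p: "p \<in> ?P" and "g' = s * g * p"
      using dc by (auto simp: double_coset_iff)
    then have "perm_mat TYPE('a) (2 * n) (w_perm n r k' l') = s * perm_mat TYPE('a) (2 * n) (w_perm n r k l) * p"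
      by (simp add: a a' w_eq)
    note inv = card_top_bot_eq[OF s p w_perm[OF a(1)] w_perm[OF a'(1)] r this]
    have "k = k'"
      using inv(1) by (simp only: card_top_set_w_perm[OF assms(2) a(1)] card_top_set_w_perm[OF assms(2) a'(1)])
    moreover have "l = l'"
      using inv(2) by (simp only: card_top_bot_w_perm[OF assms(2) a(1)] card_top_bot_w_perm[OF assms(2) a'(1)])
    ultimately show ?thesis by (simp add: a(2) a'(2))
  qed
  have dc_sub: "double_coset ?Sym ?D g ?B \<subseteq> double_coset ?GL ?S g ?P" for g
    using Delta_Sym_subset_shalika[where ?'a = 'a] Sym_prod_subset_parabolic[where ?'a = 'a]
    by (fastforce simp: double_coset_iff)
  have reps_Sym: "complete_double_coset_reps ?Sym ?D ?B ?C"
  proof (rule group.complete_double_coset_repsI[OF group_Sym_group subgroup_Delta_Sym B])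
    show "?C \<subseteq> carrier ?Sym" using wSym by blast
    show "\<exists>g\<in>?C. x \<in> double_coset ?Sym ?D g ?B" if "x \<in> carrier ?Sym" for x
      using that cover by (auto simp: Sym_def)
    show "g = g'" if "g \<in> ?C" "g' \<in> ?C" "g' \<in> double_coset ?Sym ?D g ?B" for g g'
      using uniq that dc_sub by blast
  qed
  have reps_GL: "complete_double_coset_reps ?GL ?S ?P ?C"
  proof (rule group.complete_double_coset_repsI[OF group_GL shalika_subgroup P])
    show CGL: "?C \<subseteq> carrier ?GL"
      using wSym subgroup.subset[OF subgroup_Sym, where ?'a1 = 'a] by auto
    show "\<exists>g\<in>?C. x \<in> double_coset ?GL ?S g ?P" if x: "x \<in> carrier ?GL" for x
    proof -
      obtain s \<sigma> p where s: "s \<in> ?S" and \<sigma>: "\<sigma> permutes {1..2 * n}" and p: "p \<in> ?P"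
        and xe: "x = s * perm_mat TYPE('a) (2 * n) \<sigma> * p"
        using GL_eq_shalika_perm_parabolic[OF x r] .
      let ?w = "perm_mat TYPE('a) (2 * n) \<sigma>"
      \<comment> \<open>The permutation case of \<open>cover\<close> is reused here: the double
        coset of \<open>?w\<close> in the symmetric group is contained in the one in the general
        linear group.\<close>
      obtain g where g: "g \<in> ?C" "?w \<in> double_coset ?GL ?S g ?P"
        using cover[OF \<sigma>] dc_sub by blast
      have "x \<in> double_coset ?GL ?S ?w ?P" using s p xe by (auto simp: double_coset_iff)
      also have "\<dots> = double_coset ?GL ?S g ?P"
        using group.double_coset_eq[OF group_GL shalika_subgroup P] g CGL by blast
      finally show ?thesis using g(1) by blast
    qed
  qed (fact uniq)
  \<comment> \<open>Both families are parametrized by \<open>?C\<close>, so the bijection obtained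
    matches the double cosets of the same representative.\<close>
  have "bij_betw (\<lambda>g. double_coset ?GL ?S g ?P) ?C (double_cosets ?GL ?S ?P)"
    by (rule group.bij_betw_double_cosets[OF group_GL shalika_subgroup P reps_GL])
  moreover have "bij_betw (\<lambda>g. double_coset ?Sym ?D g ?B) ?C (double_cosets ?Sym ?D ?B)"
    by (rule group.bij_betw_double_cosets[OF group_Sym_group subgroup_Delta_Sym B reps_Sym])
  ultimately have "\<exists>f. bij_betw f (double_cosets ?GL ?S ?P) (double_cosets ?Sym ?D ?B)"
    by (blast intro: bij_betw_trans bij_betw_inv_into)
  with wSym reps_Sym show ?thesis by blast
qed

end
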